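(* (Cramér model.) Let $\{\xi_j,j\ge3\}$ be independent random variables with $$\mathbb P\{\xi_j=1\}=\frac1{\log j},\qquad \mathbb P\{\xi_j=0\}=1-\frac1{\log j},$$ and let $S_n=\sum_{j=3}^n\xi_j$, $a_n=\mathbb E S_n$, $\sigma_n^2=\mathrm{Var}(S_n)$, $\vartheta_j=\frac1{\log j}$, $\nu_n=\sum_{j=3}^n\vartheta_j$. Let $\kappa_n$, $n\ge3$, be integers such that $\frac{\kappa_j-a_j}{\sigma_j}=\mathcal O(1)$ and $(\sigma_j^2-\sigma_i^2)^{1/2}\,\mathbb P\{S_j-S_i=\kappa_j-\kappa_i\}=\mathcal O(1)$ uniformly over all $j\ge i\ge2$. Then the sequence $\{Z_i,i\ge1\}$, $$Z_i=\sum_{2^i\le\nu_n<2^{i+1}}\frac{\vartheta_n\big(\mathbf 1_{\{S_n=\kappa_n\}}-\mathbb P\{S_n=\kappa_n\}\big)}{\sqrt{\nu_n}},$$ is a quasi-orthogonal system in $L^2(\mathbb P)$.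
   Context: Conventions: $S_2=0$, $\sigma_2=0$, $\kappa_2=0$. A sequence $\{f_i,i\ge1\}$ in a Hilbert space is a quasi-orthogonal system if there is a constant $L$ such that $\|\sum_{i\le n}y_if_i\|\le L(\sum_{i\le n}|y_i|^2)^{1/2}$ for all $n$ and all scalars $y_1,\dots,y_n$. *)

theory Defs
  imports "HOL-Probability.Probability"
begin

text \<open>
  The real Hilbert space \<open>L\<^sup>2(M)\<close>, represented by its square-integrable functions (not by
  classes modulo equality almost everywhere), with its norm.
\<close>

definition L2_space :: "'a measure \<Rightarrow> ('a \<Rightarrow> real) set" where
  "L2_space M = {f \<in> borel_measurable M. integrable M (\<lambda>x. (f x)\<^sup>2)}"

definition L2_norm :: "'a measure \<Rightarrow> ('a \<Rightarrow> real) \<Rightarrow> real" where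
  "L2_norm M f = sqrt (\<integral>x. (f x)\<^sup>2 \<partial>M)"

text \<open>Sequences are indexed from 1; the value of \<open>f\<close> at 0 is irrelevant.\<close>

definition quasi_orthogonal_system_L2 :: "'a measure \<Rightarrow> (nat \<Rightarrow> 'a \<Rightarrow> real) \<Rightarrow> bool" where
  "quasi_orthogonal_system_L2 M f \<longleftrightarrow>
     (\<forall>i\<ge>1. f i \<in> L2_space M) \<and>
     (\<exists>L. \<forall>n. \<forall>y :: nat \<Rightarrow> real.
        L2_norm M (\<lambda>x. \<Sum>i=1..n. y i * f i x) \<le> L * sqrt (\<Sum>i=1..n. \<bar>y i\<bar>\<^sup>2))"

text \<open>
  The index set \<open>{3..n}\<close> is empty for \<open>n = 2\<close>, so the conventions \<open>S\<^sub>2 = 0\<close>, \<open>\<sigma>\<^sub>2 = 0\<close> hold.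
\<close>

definition cramer_S :: "(nat \<Rightarrow> 'a \<Rightarrow> real) \<Rightarrow> nat \<Rightarrow> 'a \<Rightarrow> real" where
  "cramer_S \<xi> n x = (\<Sum>j=3..n. \<xi> j x)"

definition cramer_mean :: "'a measure \<Rightarrow> (nat \<Rightarrow> 'a \<Rightarrow> real) \<Rightarrow> nat \<Rightarrow> real" where
  "cramer_mean M \<xi> n = prob_space.expectation M (cramer_S \<xi> n)"

definition cramer_sd :: "'a measure \<Rightarrow> (nat \<Rightarrow> 'a \<Rightarrow> real) \<Rightarrow> nat \<Rightarrow> real" where
  "cramer_sd M \<xi> n = sqrt (prob_space.variance M (cramer_S \<xi> n))"

definition cramer_theta :: "nat \<Rightarrow> real" where
  "cramer_theta j = 1 / ln (real j)"

definition cramer_nu :: "nat \<Rightarrow> real" where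
  "cramer_nu n = (\<Sum>j=3..n. cramer_theta j)"

text \<open>
  Since \<open>\<nu>\<^sub>n\<close> tends to infinity, the index set below is finite and the sum is an ordinary one.
\<close>

definition cramer_Z ::
  "'a measure \<Rightarrow> (nat \<Rightarrow> 'a \<Rightarrow> real) \<Rightarrow> (nat \<Rightarrow> int) \<Rightarrow> nat \<Rightarrow> 'a \<Rightarrow> real" where
  "cramer_Z M \<xi> \<kappa> i x =
     (\<Sum>n | 3 \<le> n \<and> 2 ^ i \<le> cramer_nu n \<and> cramer_nu n < 2 ^ (i + 1).
        cramer_theta n *
        (of_bool (cramer_S \<xi> n x = of_int (\<kappa> n))
          - measure M {x \<in> space M. cramer_S \<xi> n x = of_int (\<kappa> n)})
        / sqrt (cramer_nu n))"

end

theory Submission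
  imports Defs "HOL-Real_Asymp.Real_Asymp"
begin

text \<open>
  For \<open>m < n\<close>, independence of the increment gives
  \<open>Cov(1{S\<^sub>m = \<kappa>\<^sub>m}, 1{S\<^sub>n = \<kappa>\<^sub>n}) = P(S\<^sub>m = \<kappa>\<^sub>m) (P(S\<^sub>n - S\<^sub>m = \<kappa>\<^sub>n - \<kappa>\<^sub>m) - P(S\<^sub>n = \<kappa>\<^sub>n))\<close>.
  The point probabilities of a sum of independent Bernoulli variables with variance \<open>V\<close> change by
  at most \<open>1 / V\<close> from one integer to the next (Fourier inversion), so the bracket is at most
  \<open>E |S\<^sub>m - \<kappa>\<^sub>m| / (\<sigma>\<^sub>n\<^sup>2 - \<sigma>\<^sub>m\<^sup>2) = O(\<sigma>\<^sub>m / (\<sigma>\<^sub>n\<^sup>2 - \<sigma>\<^sub>m\<^sup>2))\<close>; as \<open>P(S\<^sub>m = \<kappa>\<^sub>m) = O(1 / \<sigma>\<^sub>m)\<close>, the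
  covariance is \<open>O(1 / (\<nu>\<^sub>n - \<nu>\<^sub>m))\<close>. The anti-concentration hypothesis alone gives
  \<open>O(1 / sqrt (\<nu>\<^sub>m (\<nu>\<^sub>n - \<nu>\<^sub>m)))\<close>, which is better for close \<open>m\<close>, \<open>n\<close>. Summed over the dyadic
  blocks, the first bound yields \<open>E (Z\<^sub>i Z\<^sub>k) = O(r ^ |i - k|)\<close> with \<open>r = 1 / sqrt 2\<close> for \<open>|i - k| \<ge> 2\<close>,
  the second \<open>E (Z\<^sub>i\<^sup>2) = O(1)\<close>, and Schur's test applies to the Gram matrix.
\<close>

section \<open>Point probabilities of Bernoulli sums by Fourier inversion\<close>

text \<open>Concavity of \<open>sin\<close> on \<open>[0, pi/2]\<close> puts it above the chord
  \<open>2 * s / pi\<close>; the half-angle identity \<open>1 - cos t = 2 * (sin (t/2))^2\<close>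
  then gives the quadratic bound. It turns the decay of characteristic functions into Gaussian decay
  on the whole period.\<close>

lemma one_minus_cos_ge:
  fixes t :: real
  assumes "\<bar>t\<bar> \<le> pi"
  shows "1 - cos t \<ge> 2 * t\<^sup>2 / pi\<^sup>2"
proof -
  define s where "s = \<bar>t\<bar> / 2"
  have s: "0 \<le> s" "s \<le> pi / 2" using assms by (auto simp: s_def)
  have cc: "concave_on {0..pi/2} sin"
    unfolding concave_on_def
  proof (rule f''_ge0_imp_convex)
    show "((\<lambda>x. - sin x) has_real_derivative - cos x) (at x)" for x :: real
      by (auto intro!: derivative_eq_intros)
    show "((\<lambda>x. - cos x) has_real_derivative sin x) (at x)" for x :: real
      by (auto intro!: derivative_eq_intros)
    show "0 \<le> sin x" if "x \<in> {0..pi/2}" for x :: real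
      using that by (intro sin_ge_zero) auto
  qed auto
  have "sin ((1 - (2 * s / pi)) *\<^sub>R 0 + (2 * s / pi) *\<^sub>R (pi/2)) \<ge> (1 - (2 * s / pi)) * sin 0 + (2 * s / pi) * sin (pi/2)"
    using s by (intro concave_onD[OF cc]) (auto simp: field_simps)
  then have "2 * s / pi \<le> sin s" by simp
  then have "(2 * s / pi)\<^sup>2 \<le> (sin s)\<^sup>2"
    using s by (intro power_mono) auto
  moreover have "cos t = 1 - 2 * (sin s)\<^sup>2"
    using cos_double_sin[of s] by (simp add: s_def)
  ultimately show ?thesis
    by (simp add: s_def power_divide power_mult_distrib)
qed

text \<open>An explicit antiderivative exists on each side of 0, and each half contributes at most
  \<open>1 / (2 * c)\<close>. The factor \<open>\<bar>t\<bar>\<close> is what makes the bound of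
  order \<open>1 / c\<close> instead of \<open>1 / sqrt c\<close>.\<close>

lemma integral_abs_gaussian_le:
  fixes a c :: real
  assumes "a \<ge> 0" "c > 0"
  shows "(\<lambda>t. \<bar>t\<bar> * exp (- (c * t\<^sup>2))) integrable_on {-a..a}"
    and "integral {-a..a} (\<lambda>t. \<bar>t\<bar> * exp (- (c * t\<^sup>2))) \<le> 1 / c"
proof -
  let ?g = "\<lambda>t. \<bar>t\<bar> * exp (- (c * t\<^sup>2))"
  let ?G = "\<lambda>t. - (exp (- (c * t\<^sup>2))) / (2 * c)"
  have "((\<lambda>t. t * exp (- (c * t\<^sup>2))) has_integral (?G a - ?G 0)) {0..a}"
    using assms
    by (intro fundamental_theorem_of_calculus)
       (auto simp flip: has_real_derivative_iff_has_vector_derivative intro!: derivative_eq_intros)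
  then have R: "(?g has_integral (?G a - ?G 0)) {0..a}"
    by (rule has_integral_eq[rotated]) auto
  have "((\<lambda>t. - t * exp (- (c * t\<^sup>2))) has_integral (- ?G 0 - (- ?G (-a)))) {-a..0}"
    using assms
    by (intro fundamental_theorem_of_calculus)
       (auto simp flip: has_real_derivative_iff_has_vector_derivative intro!: derivative_eq_intros)
  then have L: "(?g has_integral (- ?G 0 - (- ?G (-a)))) {-a..0}"
    by (rule has_integral_eq[rotated]) auto
  have T: "(?g has_integral ((- ?G 0 - (- ?G (-a))) + (?G a - ?G 0))) {-a..a}"
    using assms by (intro has_integral_combine[OF _ _ L R]) auto
  then show "?g integrable_on {-a..a}" by blast
  have "(- ?G 0 - (- ?G (-a))) + (?G a - ?G 0) = (1 - exp (- (c * a\<^sup>2))) / c"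
    using assms by (simp add: field_simps)
  also have "\<dots> \<le> 1 / c" using assms by (intro divide_right_mono) auto
  finally show "integral {-a..a} ?g \<le> 1 / c"
    using integral_unique[OF T] by simp
qed

text \<open>
  The \<open>k\<close>-th Fourier coefficient of the characteristic function of \<open>\<Sum>j\<in>A. X\<^sub>j\<close>. It is identified with
  the point probability through the common recursion in \<open>A\<close>, which avoids exchanging integrals.
\<close>

definition bernoulli_coeff :: "('i \<Rightarrow> real) \<Rightarrow> 'i set \<Rightarrow> int \<Rightarrow> complex" where
  "bernoulli_coeff p A k =
     integral {-pi..pi} (\<lambda>t. cis (- (of_int k * t)) * (\<Prod>j\<in>A. of_real (1 - p j) + of_real (p j) * cis t))
       / of_real (2 * pi)"

text \<open>Orthogonality of the characters; this is the base of the recursion.\<close>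

lemma bernoulli_coeff_empty: "bernoulli_coeff p {} k = of_bool (k = 0)"
proof (cases "k = 0")
  case True
  then show ?thesis by (simp add: bernoulli_coeff_def scaleR_conv_of_real)
next
  case False
  let ?F = "\<lambda>t. cis (- (of_int k * t)) * (\<i> / of_int k)"
  have "((\<lambda>t. cis (- (of_int k * t))) has_integral (?F pi - ?F (-pi))) {-pi..pi}"
  proof (rule fundamental_theorem_of_calculus)
    show "(?F has_vector_derivative cis (- (of_int k * t))) (at t within {- pi..pi})" for t
      unfolding cis_conv_exp using False
      by (auto intro!: derivative_eq_intros has_vector_derivative_real_field simp: field_simps)
  qed auto
  \<comment> \<open>The two endpoints differ by a full number of turns, because
    \<open>sin (k * pi) = 0\<close> for an integer \<open>k\<close>.\<close>
  moreover have "?F pi = ?F (-pi)"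
    using False sin_integer_2pi sin_times_pi_eq_0[of "of_int k"] by (simp add: complex_eq_iff)
  ultimately show ?thesis
    using False by (simp add: bernoulli_coeff_def integral_unique)
qed

text \<open>In the factor of the new index, multiplication by \<open>cis t\<close> lowers the
  frequency from \<open>k\<close> to \<open>k - 1\<close>. This mirrors conditioning on whether the
  new variable is 1 or 0.\<close>

lemma bernoulli_coeff_insert:
  assumes "finite A" "j \<notin> A"
  shows "bernoulli_coeff p (insert j A) k =
    of_real (p j) * bernoulli_coeff p A (k - 1) + of_real (1 - p j) * bernoulli_coeff p A k"
proof -
  let ?P = "\<lambda>t. \<Prod>j\<in>A. of_real (1 - p j) + of_real (p j) * cis t"
  have int: "(\<lambda>t. cis (- (of_int k * t)) * ?P t) integrable_on {-pi..pi}" for k :: int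
    by (intro integrable_continuous_interval continuous_intros)
  let ?f = "\<lambda>k t. cis (- (of_int k * t)) * ?P t"
  have "cis (- (of_int k * t)) * (\<Prod>j\<in>insert j A. of_real (1 - p j) + of_real (p j) * cis t)
     = of_real (p j) * ?f (k - 1) t + of_real (1 - p j) * ?f k t" for t
  proof -
    have "cis (- (of_int (k - 1) * t)) = cis (- (of_int k * t)) * cis t"
      by (simp add: cis_mult algebra_simps)
    then show ?thesis using assms by (simp add: algebra_simps)
  qed
  then have "integral {-pi..pi} (\<lambda>t. cis (- (of_int k * t)) * (\<Prod>j\<in>insert j A. of_real (1 - p j) + of_real (p j) * cis t))
     = integral {-pi..pi} (\<lambda>t. of_real (p j) * ?f (k - 1) t + of_real (1 - p j) * ?f k t)"
    by presburger
  also have "\<dots> = of_real (p j) * integral {-pi..pi} (?f (k - 1))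
      + of_real (1 - p j) * integral {-pi..pi} (?f k)"
    by (subst integral_add) (auto intro!: integrable_on_mult_right int simp del: of_int_diff of_real_diff)
  finally show ?thesis
    unfolding bernoulli_coeff_def by (simp only: add_divide_distrib times_divide_eq_right)
qed

text \<open>The squared modulus equals \<open>1 - 2 * p * (1 - p) * (1 - cos t)\<close>, and
  \<open>1 + x \<le> exp x\<close>. The exponent carries the variance \<open>p * (1 - p)\<close>, so
  a product of such factors carries the total variance.\<close>

lemma norm_bernoulli_factor_le:
  fixes p t :: real
  assumes "0 \<le> p" "p \<le> 1"
  shows "norm (of_real (1 - p) + of_real p * cis t) \<le> exp (- (p * (1 - p) * (1 - cos t)))"
proof -
  have "(norm (of_real (1 - p) + of_real p * cis t))\<^sup>2 = (1 - p + p * cos t)\<^sup>2 + (p * sin t)\<^sup>2"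
    by (simp add: cmod_power2)
  also have "\<dots> = 1 - 2 * p * (1 - p) * (1 - cos t)"
    using sin_cos_squared_add[of t] by algebra
  also have "\<dots> \<le> exp (- (2 * p * (1 - p) * (1 - cos t)))"
    using exp_ge_add_one_self[of "- (2 * p * (1 - p) * (1 - cos t))"] by simp
  also have "\<dots> = (exp (- (p * (1 - p) * (1 - cos t))))\<^sup>2"
    by (simp add: power2_eq_square flip: exp_add)
  finally show ?thesis
    by (rule power2_le_imp_le) auto
qed

text \<open>A chord, of length \<open>2 * \<bar>sin (t/2)\<bar>\<close>, is no longer than its
  arc.\<close>

lemma norm_cis_minus_one_le: "norm (cis t - 1) \<le> \<bar>t\<bar>"
proof -
  have "(norm (cis t - 1))\<^sup>2 = (cos t - 1)\<^sup>2 + (sin t)\<^sup>2"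
    by (simp add: cmod_power2)
  also have "\<dots> = 2 - 2 * cos t"
    using sin_cos_squared_add[of t] by (simp add: power2_diff)
  also have "\<dots> = (2 * sin (t/2))\<^sup>2"
    using cos_double_sin[of "t/2"] by (simp add: power_mult_distrib)
  also have "\<dots> = (2 * \<bar>sin (t/2)\<bar>)\<^sup>2" by (simp add: power_mult_distrib)
  finally have "norm (cis t - 1) = 2 * \<bar>sin (t/2)\<bar>"
    by (rule power2_eq_imp_eq) auto
  then show ?thesis using abs_sin_x_le_abs_x[of "t/2"] by simp
qed

text \<open>Differencing in \<open>k\<close> multiplies the integrand by
  \<open>1 - cis (-t)\<close>, of modulus at most \<open>\<bar>t\<bar>\<close>, while the product is
  at most \<open>exp (- (c * t^2))\<close>. The integral is at most \<open>1 / c\<close>, and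
  dividing by \<open>2 * pi\<close> leaves \<open>pi / (4 * V)\<close>, which is below
  \<open>1 / V\<close>.\<close>

lemma bernoulli_coeff_step:
  assumes "finite A" "\<And>j. j \<in> A \<Longrightarrow> 0 \<le> p j \<and> p j \<le> 1"
    and V: "V = (\<Sum>j\<in>A. p j * (1 - p j))" "V > 0"
  shows "norm (bernoulli_coeff p A k - bernoulli_coeff p A (k + 1)) \<le> 1 / V"
proof -
  let ?P = "\<lambda>t. \<Prod>j\<in>A. of_real (1 - p j) + of_real (p j) * cis t"
  \<comment> \<open>The constant with \<open>V * (1 - cos t) \<ge> c * t^2\<close> on the period, by
    \<open>one_minus_cos_ge\<close>.\<close>
  define c where "c = 2 * V / pi\<^sup>2"
  have c: "c > 0" using V by (simp add: c_def)
  have int: "(\<lambda>t. cis (- (of_int k * t)) * ?P t) integrable_on {-pi..pi}" for k :: int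
    by (intro integrable_continuous_interval continuous_intros)
  have P: "norm (?P t) \<le> exp (- (c * t\<^sup>2))" if "t \<in> {-pi..pi}" for t
  proof -
    have "norm (?P t) \<le> (\<Prod>j\<in>A. exp (- (p j * (1 - p j) * (1 - cos t))))"
      unfolding prod_norm[symmetric]
      using assms by (intro prod_mono) (auto intro!: norm_bernoulli_factor_le simp del: of_real_diff)
    also have "\<dots> = exp (- (V * (1 - cos t)))"
      using assms(1) by (simp add: V exp_sum sum_distrib_right flip: sum_negf)
    also have "\<dots> \<le> exp (- (c * t\<^sup>2))"
      using mult_left_mono[OF one_minus_cos_ge[of t], of V] that V
      by (auto simp: c_def field_simps abs_le_iff)
    finally show ?thesis .
  qed
  have "bernoulli_coeff p A k - bernoulli_coeff p A (k + 1) =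
      integral {-pi..pi} (\<lambda>t. cis (- (of_int k * t)) * ?P t - cis (- (of_int (k + 1) * t)) * ?P t)
        / of_real (2 * pi)"
    unfolding bernoulli_coeff_def by (subst integral_diff[OF int int]) (simp add: diff_divide_distrib)
  also have "norm \<dots> \<le> (1 / c) / (2 * pi)"
    unfolding norm_divide
  proof (intro frac_le)
    have "norm (integral {-pi..pi} (\<lambda>t. cis (- (of_int k * t)) * ?P t - cis (- (of_int (k + 1) * t)) * ?P t))
        \<le> integral {-pi..pi} (\<lambda>t. \<bar>t\<bar> * exp (- (c * t\<^sup>2)))"
    proof (rule integral_norm_bound_integral)
      show "(\<lambda>t. \<bar>t\<bar> * exp (- (c * t\<^sup>2))) integrable_on {-pi..pi}"
        by (rule integral_abs_gaussian_le) (use c in auto)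
      fix t :: real assume t: "t \<in> {-pi..pi}"
      have "cis (- (of_int k * t)) * ?P t - cis (- (of_int (k + 1) * t)) * ?P t
          = - cis (- (of_int k * t)) * (cis (-t) - 1) * ?P t"
        by (simp add: cis_mult algebra_simps)
      also have "norm \<dots> = norm (cis (-t) - 1) * norm (?P t)"
        by (simp add: norm_mult)
      also have "\<dots> \<le> \<bar>t\<bar> * exp (- (c * t\<^sup>2))"
        using norm_cis_minus_one_le[of "-t"] P[OF t] by (intro mult_mono) auto
      finally show "norm (cis (- (of_int k * t)) * ?P t - cis (- (of_int (k + 1) * t)) * ?P t)
          \<le> \<bar>t\<bar> * exp (- (c * t\<^sup>2))" .
    qed (intro integrable_diff int)
    also have "\<dots> \<le> 1 / c"
      by (rule integral_abs_gaussian_le) (use c in auto)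
    finally show "norm (integral {-pi..pi} (\<lambda>t. cis (- (of_int k * t)) * ?P t - cis (- (of_int (k + 1) * t)) * ?P t)) \<le> 1 / c" .
  qed (use c in auto)
  also have "\<dots> = (pi / 4) / V"
    by (simp add: c_def power2_eq_square)
  also have "\<dots> \<le> 1 / V"
    using pi_less_4 V by (intro divide_right_mono) auto
  finally show ?thesis .
qed

section \<open>Sums of independent Bernoulli variables\<close>

text \<open>Index set and success probabilities are left general, so that the results apply both to
  initial sums and to increments. The two prescribed masses add up to 1, so other values occur only
  on a null set.\<close>

locale indep_bernoulli = prob_space M for M :: "'a measure" +
  fixes X :: "'i \<Rightarrow> 'a \<Rightarrow> real" and I :: "'i set" and p :: "'i \<Rightarrow> real"
  assumes indep: "indep_vars (\<lambda>_. borel) X I"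
    and prob_1: "j \<in> I \<Longrightarrow> \<P>(x in M. X j x = 1) = p j"
    and prob_0: "j \<in> I \<Longrightarrow> \<P>(x in M. X j x = 0) = 1 - p j"
begin

section \<open>Values, independence and convolution of finite sums\<close>

lemma measurable_X [measurable]: "j \<in> I \<Longrightarrow> X j \<in> borel_measurable M"
  using indep unfolding indep_vars_def by auto

lemma measurable_sum_X: "A \<subseteq> I \<Longrightarrow> (\<lambda>x. \<Sum>j\<in>A. X j x) \<in> borel_measurable M"
  by (intro borel_measurable_sum) auto

lemma p_bounds: "j \<in> I \<Longrightarrow> 0 \<le> p j \<and> p j \<le> 1"
  using prob_1[of j] prob_0[of j] measure_nonneg[of M "{x \<in> space M. X j x = 1}"]
    measure_nonneg[of M "{x \<in> space M. X j x = 0}"] by linarith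

lemma AE_zero_one:
  assumes "j \<in> I" shows "AE x in M. X j x = 0 \<or> X j x = 1"
proof -
  have [measurable]: "X j \<in> borel_measurable M" using assms by simp
  have "\<P>(x in M. X j x = 0 \<or> X j x = 1) = \<P>(x in M. X j x = 0) + \<P>(x in M. X j x = 1)"
    by (subst finite_measure_Union[symmetric]) (auto intro!: arg_cong[where f=prob])
  also have "\<dots> = 1" using prob_0 prob_1 assms by simp
  finally show ?thesis
    by (subst (asm) prob_Collect_eq_1) auto
qed

text \<open>The finite range reduces all conditioning on the value of a sum to finite sums over
  integers.\<close>

lemma AE_sum_int:
  assumes "finite A" "A \<subseteq> I"
  shows "AE x in M. \<exists>s\<in>{0..int (card A)}. (\<Sum>j\<in>A. X j x) = of_int s"
  using assms
proof (induction A)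
  case (insert j A)
  have "AE x in M. X j x = 0 \<or> X j x = 1"
    using insert by (intro AE_zero_one) auto
  moreover have "AE x in M. \<exists>s\<in>{0..int (card A)}. (\<Sum>j\<in>A. X j x) = of_int s"
    using insert by auto
  ultimately show ?case
  proof eventually_elim
    case (elim x)
    then obtain s where s: "s \<in> {0..int (card A)}" "(\<Sum>j\<in>A. X j x) = of_int s" by auto
    show ?case
      using elim(1) s insert.hyps by (auto intro: bexI[of _ s] bexI[of _ "s + 1"])
  qed
qed auto

lemma indep_sums:
  assumes "A \<inter> B = {}" "A \<subseteq> I" "B \<subseteq> I"
  shows "indep_var borel (\<lambda>x. \<Sum>j\<in>A. X j x) borel (\<lambda>x. \<Sum>j\<in>B. X j x)"
proof -
  have "indep_var
    borel ((\<lambda>f. \<Sum>i\<in>A. f i) \<circ> (\<lambda>\<omega>. restrict (\<lambda>i. X i \<omega>) A))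
    borel ((\<lambda>f. \<Sum>i\<in>B. f i) \<circ> (\<lambda>\<omega>. restrict (\<lambda>i. X i \<omega>) B))"
    using assms by (intro indep_var_compose[OF indep_var_restrict[OF indep]]) auto
  also have "((\<lambda>f. \<Sum>i\<in>A. f i) \<circ> (\<lambda>\<omega>. restrict (\<lambda>i. X i \<omega>) A)) = (\<lambda>\<omega>. \<Sum>i\<in>A. X i \<omega>)"
    by (auto cong: rev_conj_cong)
  also have "((\<lambda>f. \<Sum>i\<in>B. f i) \<circ> (\<lambda>\<omega>. restrict (\<lambda>i. X i \<omega>) B)) = (\<lambda>\<omega>. \<Sum>i\<in>B. X i \<omega>)"
    by (auto cong: rev_conj_cong)
  finally show ?thesis .
qed

lemma prob_sums_eq:
  assumes "A \<inter> B = {}" "A \<subseteq> I" "B \<subseteq> I"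
  shows "\<P>(x in M. (\<Sum>j\<in>A. X j x) = a \<and> (\<Sum>j\<in>B. X j x) = b) =
    \<P>(x in M. (\<Sum>j\<in>A. X j x) = a) * \<P>(x in M. (\<Sum>j\<in>B. X j x) = b)"
  using prob_indep_random_variable[OF indep_sums[OF assms], of "{a}" "{b}"] by simp

lemma prob_partition_sum:
  assumes "finite A" "A \<subseteq> I" "E \<in> events"
  shows "prob E = (\<Sum>s\<in>{0..int (card A)}. \<P>(x in M. x \<in> E \<and> (\<Sum>j\<in>A. X j x) = of_int s))"
proof -
  note [measurable] = measurable_sum_X[OF assms(2)] assms(3)
  have "prob E = \<P>(x in M. x \<in> E \<and> (\<exists>s\<in>{0..int (card A)}. (\<Sum>j\<in>A. X j x) = of_int s))"
  proof (rule finite_measure_eq_AE)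
    show "AE x in M. (x \<in> E) = (x \<in> {x \<in> space M. x \<in> E \<and> (\<exists>s\<in>{0..int (card A)}. (\<Sum>j\<in>A. X j x) = of_int s)})"
      using AE_sum_int[OF assms(1,2)] AE_space by eventually_elim blast
    show "{x \<in> space M. x \<in> E \<and> (\<exists>s\<in>{0..int (card A)}. (\<Sum>j\<in>A. X j x) = of_int s)} \<in> events"
      by measurable
  qed fact
  also have "{x \<in> space M. x \<in> E \<and> (\<exists>s\<in>{0..int (card A)}. (\<Sum>j\<in>A. X j x) = of_int s)}
     = (\<Union>s\<in>{0..int (card A)}. {x \<in> space M. x \<in> E \<and> (\<Sum>j\<in>A. X j x) = of_int s})" by auto
  also have "prob \<dots> = (\<Sum>s\<in>{0..int (card A)}. \<P>(x in M. x \<in> E \<and> (\<Sum>j\<in>A. X j x) = of_int s))"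
    by (rule finite_measure_finite_Union) (auto simp: disjoint_family_on_def)
  finally show ?thesis .
qed

text \<open>Total probability over the value of the first sum, then independence. It serves twice:
  with a singleton \<open>A\<close> for the Fourier recursion, and with an initial segment for
  conditioning on \<open>S_m\<close>.\<close>

lemma prob_sum_convolution:
  assumes "A \<inter> B = {}" "finite A" "A \<subseteq> I" "finite B" "B \<subseteq> I"
  shows "\<P>(x in M. (\<Sum>j\<in>A\<union>B. X j x) = of_int k) =
    (\<Sum>s\<in>{0..int (card A)}. \<P>(x in M. (\<Sum>j\<in>A. X j x) = of_int s)
                             * \<P>(x in M. (\<Sum>j\<in>B. X j x) = of_int (k - s)))"
proof -
  note [measurable] = measurable_sum_X[OF assms(3)] measurable_sum_X[OF assms(5)]
  have U: "(\<Sum>j\<in>A\<union>B. X j x) = (\<Sum>j\<in>A. X j x) + (\<Sum>j\<in>B. X j x)" for x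
    using assms by (intro sum.union_disjoint) auto
  have "\<P>(x in M. (\<Sum>j\<in>A\<union>B. X j x) = of_int k) =
    (\<Sum>s\<in>{0..int (card A)}. \<P>(x in M. (\<Sum>j\<in>A. X j x) = of_int s \<and> (\<Sum>j\<in>B. X j x) = of_int (k - s)))"
    unfolding U using assms
    by (subst prob_partition_sum[of A]) (auto intro!: sum.cong arg_cong[where f=prob])
  then show ?thesis
    using assms by (simp only: prob_sums_eq)
qed

text \<open>Both sides are the indicator of \<open>k = 0\<close> for the empty set and obey the same
  recursion when an index is added.\<close>

lemma prob_sum_eq_coeff:
  assumes "finite A" "A \<subseteq> I"
  shows "of_real (\<P>(x in M. (\<Sum>j\<in>A. X j x) = of_int k)) = bernoulli_coeff p A k"
  using assms
proof (induction A arbitrary: k)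
  case empty
  then show ?case by (auto simp: bernoulli_coeff_empty prob_space)
next
  case (insert j A)
  \<comment> \<open>The convolution with the singleton \<open>{j}\<close> has only the terms
    \<open>s = 0\<close> and \<open>s = 1\<close>.\<close>
  have "\<P>(x in M. (\<Sum>j\<in>insert j A. X j x) = of_int k) =
      (1 - p j) * \<P>(x in M. (\<Sum>j\<in>A. X j x) = of_int k) + p j * \<P>(x in M. (\<Sum>j\<in>A. X j x) = of_int (k - 1))"
    using prob_sum_convolution[of "{j}" A k] insert prob_0[of j] prob_1[of j]
    by (simp add: atLeastAtMostPlus1_int_conv[of 0 0, simplified])
  then have "of_real (\<P>(x in M. (\<Sum>j\<in>insert j A. X j x) = of_int k)) =
      of_real (1 - p j) * bernoulli_coeff p A k + of_real (p j) * bernoulli_coeff p A (k - 1)"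
    using insert by (simp del: of_int_diff of_real_diff flip: insert.IH)
  then show ?case
    using bernoulli_coeff_insert[of A j p k] insert by simp
qed

text \<open>The unit steps of \<open>bernoulli_coeff_step\<close> telescope between the two
  integers.\<close>

lemma prob_sum_lipschitz:
  assumes "finite A" "A \<subseteq> I" and V: "(\<Sum>j\<in>A. p j * (1 - p j)) > 0"
  shows "\<bar>\<P>(x in M. (\<Sum>j\<in>A. X j x) = of_int k) - \<P>(x in M. (\<Sum>j\<in>A. X j x) = of_int l)\<bar>
    \<le> \<bar>of_int k - of_int l\<bar> / (\<Sum>j\<in>A. p j * (1 - p j))"
proof -
  let ?f = "\<lambda>k. \<P>(x in M. (\<Sum>j\<in>A. X j x) = of_int k)" and ?V = "\<Sum>j\<in>A. p j * (1 - p j)"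
  have step: "\<bar>?f k - ?f (k + 1)\<bar> \<le> 1 / ?V" for k
  proof -
    have "of_real (?f k - ?f (k + 1)) = bernoulli_coeff p A k - bernoulli_coeff p A (k + 1)"
      using prob_sum_eq_coeff[OF assms(1,2)] by (simp del: of_int_add)
    then show ?thesis
      using bernoulli_coeff_step[of A p ?V k] assms p_bounds norm_of_real[of "?f k - ?f (k + 1)", where 'a = complex]
      by (auto simp del: of_int_add of_real_diff norm_of_real)
  qed
  have "\<bar>?f k - ?f (k + int n)\<bar> \<le> real n / ?V" for k n
  proof (induction n)
    case (Suc n)
    have "real (Suc n) / ?V = real n / ?V + 1 / ?V" "k + int (Suc n) = k + int n + 1"
      by (simp_all add: add_divide_distrib)
    then show ?case using Suc step[of "k + int n"] by (simp only:)
  qed simp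
  note * = this
  have **: "\<bar>?f a - ?f b\<bar> \<le> (of_int b - of_int a) / ?V" if "a \<le> b" for a b
    using that *[of a "nat (b - a)"] by simp
  show ?thesis
    using **[of k l] **[of l k] by (cases "k \<le> l") (auto simp: abs_minus_commute)
qed

section \<open>Moments of finite sums\<close>

lemma AE_bounded_X: "j \<in> I \<Longrightarrow> AE x in M. \<bar>X j x\<bar> \<le> 1"
  using AE_zero_one[of j] by (auto elim!: eventually_mono)

lemma integrable_X: "j \<in> I \<Longrightarrow> integrable M (X j)"
  using AE_bounded_X[of j] by (intro integrable_const_bound[where B=1]) auto

lemma expectation_X: assumes "j \<in> I" shows "expectation (X j) = p j"
proof -
  note [measurable] = measurable_X[OF assms]
  have "expectation (X j) = expectation (indicator {x\<in>space M. X j x = 1})"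
    using AE_zero_one[OF assms] AE_space
    by (intro integral_cong_AE) (auto elim!: eventually_elim2 simp: indicator_def)
  then show ?thesis using prob_1[OF assms] by simp
qed

lemma
  assumes "finite A" "A \<subseteq> I"
  shows integrable_sum_X: "integrable M (\<lambda>x. \<Sum>j\<in>A. X j x)"
    and integrable_sum_X_square: "integrable M (\<lambda>x. (\<Sum>j\<in>A. X j x)\<^sup>2)"
    and expectation_sum_X: "expectation (\<lambda>x. \<Sum>j\<in>A. X j x) = (\<Sum>j\<in>A. p j)"
proof -
  note [measurable] = measurable_sum_X[OF assms(2)]
  show "integrable M (\<lambda>x. \<Sum>j\<in>A. X j x)"
    using assms by (auto intro: integrable_X)
  have "AE x in M. norm ((\<Sum>j\<in>A. X j x)\<^sup>2) \<le> (real (card A))\<^sup>2"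
    using AE_sum_int[OF assms]
    by eventually_elim (auto intro!: power_mono)
  then show "integrable M (\<lambda>x. (\<Sum>j\<in>A. X j x)\<^sup>2)"
    by (rule integrable_const_bound) measurable
  show "expectation (\<lambda>x. \<Sum>j\<in>A. X j x) = (\<Sum>j\<in>A. p j)"
    using assms by (subst Bochner_Integration.integral_sum) (auto intro!: sum.cong integrable_X expectation_X)
qed

text \<open>Induction on the second moment: the new variable equals its own square almost
  everywhere, and independence factors the cross term.\<close>

lemma variance_sum_X:
  assumes "finite A" "A \<subseteq> I"
  shows "variance (\<lambda>x. \<Sum>j\<in>A. X j x) = (\<Sum>j\<in>A. p j * (1 - p j))"
proof -
  have "expectation (\<lambda>x. (\<Sum>j\<in>A. X j x)\<^sup>2) = (\<Sum>j\<in>A. p j * (1 - p j)) + (\<Sum>j\<in>A. p j)\<^sup>2"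
    using assms
  proof (induction A)
    case (insert j A)
    have j: "j \<in> I" "{j} \<subseteq> I" "A \<subseteq> I" using insert by auto
    note [measurable] = measurable_X[OF j(1)]
    have int: "integrable M (\<lambda>x. (X j x)\<^sup>2)" "integrable M (\<lambda>x. (\<Sum>i\<in>A. X i x)\<^sup>2)"
       "integrable M (X j)" "integrable M (\<lambda>x. \<Sum>i\<in>A. X i x)"
      using integrable_sum_X_square[of "{j}"] integrable_sum_X_square[of A]
         integrable_sum_X[of A] integrable_X[OF j(1)] insert by auto
    have ind: "indep_var borel (X j) borel (\<lambda>x. \<Sum>i\<in>A. X i x)"
      using indep_sums[of "{j}" A] insert by simp
    have "expectation (\<lambda>x. (X j x)\<^sup>2) = expectation (X j)"
      using AE_zero_one[OF j(1)] by (intro integral_cong_AE) (auto elim!: eventually_mono)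
    then have 1: "expectation (\<lambda>x. (X j x)\<^sup>2) = p j" using expectation_X j by simp
    have "(\<Sum>j\<in>insert j A. X j x)\<^sup>2 = (X j x)\<^sup>2 + (\<Sum>j\<in>A. X j x)\<^sup>2 + 2 * (X j x * (\<Sum>j\<in>A. X j x))" for x
      using insert by (simp add: power2_sum)
    then have "expectation (\<lambda>x. (\<Sum>j\<in>insert j A. X j x)\<^sup>2)
       = p j + expectation (\<lambda>x. (\<Sum>j\<in>A. X j x)\<^sup>2) + 2 * (p j * (\<Sum>j\<in>A. p j))"
      using int indep_var_integrable[OF ind int(3,4)] indep_var_lebesgue_integral[OF ind int(3,4)]
        expectation_X[OF j(1)] expectation_sum_X[of A] insert
      by (simp add: 1)
    then show ?case
      using insert by (simp add: algebra_simps power2_eq_square)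
  qed simp
  then show ?thesis
    using variance_eq[OF integrable_sum_X[OF assms] integrable_sum_X_square[OF assms]]
      expectation_sum_X[OF assms] by simp
qed

text \<open>The standard deviation bounds the mean distance from the mean by
  \<open>\<sigma>\<close>, and moving the centre to \<open>k\<close> costs at most
  \<open>C * \<sigma>\<close>.\<close>

lemma expectation_abs_deviation_le:
  assumes "finite A" "A \<subseteq> I" "\<sigma> > 0"
    and V: "(\<Sum>j\<in>A. p j * (1 - p j)) = \<sigma>\<^sup>2" and d: "\<bar>k - (\<Sum>j\<in>A. p j)\<bar> \<le> C * \<sigma>"
  shows "expectation (\<lambda>x. \<bar>(\<Sum>j\<in>A. X j x) - k\<bar>) \<le> (1 + C) * \<sigma>"
proof -
  let ?S = "\<lambda>x. \<Sum>j\<in>A. X j x" and ?m = "\<Sum>j\<in>A. p j"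
  note int = integrable_sum_X[OF assms(1,2)] integrable_sum_X_square[OF assms(1,2)]
  have int2: "integrable M (\<lambda>x. (?S x - ?m)\<^sup>2)"
    using int by (simp add: power2_diff)
  have "expectation (\<lambda>x. \<bar>?S x - k\<bar>) \<le> expectation (\<lambda>x. (?S x - ?m)\<^sup>2 / (2 * \<sigma>) + (\<sigma> / 2 + C * \<sigma>))"
  proof (rule integral_mono)
    fix x
    \<comment> \<open>A pointwise form of Cauchy-Schwarz, balanced so that both terms on the right
      have expectation \<open>\<sigma> / 2\<close>.\<close>
    have "0 \<le> (\<bar>?S x - ?m\<bar> - \<sigma>)\<^sup>2" by simp
    then have "2 * \<bar>?S x - ?m\<bar> * \<sigma> \<le> (?S x - ?m)\<^sup>2 + \<sigma>\<^sup>2"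
      by (simp add: power2_diff)
    then have "\<bar>?S x - ?m\<bar> \<le> (?S x - ?m)\<^sup>2 / (2 * \<sigma>) + \<sigma> / 2"
      using \<open>\<sigma> > 0\<close> by (simp add: field_simps power2_eq_square)
    then show "\<bar>?S x - k\<bar> \<le> (?S x - ?m)\<^sup>2 / (2 * \<sigma>) + (\<sigma> / 2 + C * \<sigma>)"
      using d by linarith
  qed (use int int2 in auto)
  also have "\<dots> = variance ?S / (2 * \<sigma>) + (\<sigma> / 2 + C * \<sigma>)"
    using int2 expectation_sum_X[OF assms(1,2)] by (simp add: prob_space)
  also have "\<dots> = (1 + C) * \<sigma>"
    using \<open>\<sigma> > 0\<close> unfolding variance_sum_X[OF assms(1,2)] V
    by (simp add: field_simps power2_eq_square)
  finally show ?thesis .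
qed

text \<open>Given \<open>S\<^sub>A = s\<close>, the total \<open>S\<^sub>A + S\<^sub>B\<close> hits \<open>k + l\<close> with probability \<open>f\<^sub>B (k + l - s)\<close>, and
  \<open>f\<^sub>B\<close> is Lipschitz, so the conditioning costs at most the mean distance of \<open>S\<^sub>A\<close> from \<open>k\<close>.\<close>

lemma prob_sum_union_diff_le:
  assumes "A \<inter> B = {}" "finite A" "A \<subseteq> I" "finite B" "B \<subseteq> I"
    and V: "(\<Sum>j\<in>B. p j * (1 - p j)) > 0"
  shows "\<bar>\<P>(x in M. (\<Sum>j\<in>B. X j x) = of_int l) - \<P>(x in M. (\<Sum>j\<in>A\<union>B. X j x) = of_int (k + l))\<bar>
    \<le> expectation (\<lambda>x. \<bar>(\<Sum>j\<in>A. X j x) - of_int k\<bar>) / (\<Sum>j\<in>B. p j * (1 - p j))"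
proof -
  let ?R = "{0..int (card A)}" and ?V = "\<Sum>j\<in>B. p j * (1 - p j)"
  let ?q = "\<lambda>s. \<P>(x in M. (\<Sum>j\<in>A. X j x) = of_int s)"
  let ?f = "\<lambda>s. \<P>(x in M. (\<Sum>j\<in>B. X j x) = of_int s)"
  note [measurable] = measurable_sum_X[OF assms(3)]
  have q1: "(\<Sum>s\<in>?R. ?q s) = 1"
    using prob_partition_sum[of A "space M"] assms by (simp add: prob_space)
  have "expectation (\<lambda>x. \<bar>(\<Sum>j\<in>A. X j x) - of_int k\<bar>)
     = expectation (\<lambda>x. \<Sum>s\<in>?R. \<bar>of_int s - of_int k\<bar> * indicator {x\<in>space M. (\<Sum>j\<in>A. X j x) = of_int s} x)"
  proof (rule integral_cong_AE)
    show "AE x in M. \<bar>(\<Sum>j\<in>A. X j x) - of_int k\<bar> =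
      (\<Sum>s\<in>?R. \<bar>of_int s - of_int k\<bar> * indicator {x\<in>space M. (\<Sum>j\<in>A. X j x) = of_int s} x)"
      using AE_sum_int[OF assms(2,3)] AE_space
    proof eventually_elim
      case (elim x)
      then obtain s where s: "s \<in> ?R" "(\<Sum>j\<in>A. X j x) = of_int s" by auto
      have "(\<Sum>s\<in>?R. \<bar>of_int s - of_int k\<bar> * indicator {x\<in>space M. (\<Sum>j\<in>A. X j x) = of_int s} x)
          = (\<Sum>s'\<in>?R. if s' = s then \<bar>of_int s - of_int k :: real\<bar> else 0)"
        using s elim by (intro sum.cong) (auto simp: indicator_def)
      then show ?case using s by simp
    qed
  qed measurable
  also have "\<dots> = (\<Sum>s\<in>?R. \<bar>of_int s - of_int k\<bar> * ?q s)"
  proof -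
    have "integrable M (indicator {x\<in>space M. (\<Sum>j\<in>A. X j x) = of_int s} :: 'a \<Rightarrow> real)" for s
      by (rule integrable_const_bound[where B=1]) (auto simp: indicator_def)
    then show ?thesis
      by (subst Bochner_Integration.integral_sum) auto
  qed
  finally have E: "expectation (\<lambda>x. \<bar>(\<Sum>j\<in>A. X j x) - of_int k\<bar>) = (\<Sum>s\<in>?R. \<bar>of_int s - of_int k\<bar> * ?q s)" .
  \<comment> \<open>The weights \<open>?q s\<close> sum to 1, so \<open>?f l\<close> can be moved
    inside the average over \<open>s\<close>.\<close>
  have D: "?f l - \<P>(x in M. (\<Sum>j\<in>A\<union>B. X j x) = of_int (k + l)) = (\<Sum>s\<in>?R. ?q s * (?f l - ?f (k + l - s)))"
    unfolding prob_sum_convolution[OF assms(1-5)]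
    by (simp only: right_diff_distrib sum_subtractf q1 mult_1_left flip: sum_distrib_right)
  have "\<bar>\<Sum>s\<in>?R. ?q s * (?f l - ?f (k + l - s))\<bar> \<le> (\<Sum>s\<in>?R. ?q s * (\<bar>of_int s - of_int k\<bar> / ?V))"
  proof (rule order_trans[OF sum_abs sum_mono])
    fix s
    \<comment> \<open>The arguments \<open>l\<close> and \<open>k + l - s\<close> lie at distance
      \<open>\<bar>s - k\<bar>\<close>.\<close>
    show "\<bar>?q s * (?f l - ?f (k + l - s))\<bar> \<le> ?q s * (\<bar>of_int s - of_int k\<bar> / ?V)"
      using prob_sum_lipschitz[OF assms(4,5) V, of l "k + l - s"]
      unfolding abs_mult by (intro mult_mono) (auto simp: algebra_simps)
  qed
  also have "\<dots> = expectation (\<lambda>x. \<bar>(\<Sum>j\<in>A. X j x) - of_int k\<bar>) / ?V"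
    unfolding E by (simp add: sum_divide_distrib mult.commute)
  finally show ?thesis unfolding D .
qed

end

section \<open>Quasi-orthogonality from decay of the Gram matrix\<close>

lemma integrable_mult_L2_space:
  assumes "f \<in> L2_space M" "g \<in> L2_space M"
  shows "integrable M (\<lambda>x. f x * g x)"
proof (rule Bochner_Integration.integrable_bound)
  show "integrable M (\<lambda>x. (f x)\<^sup>2 + (g x)\<^sup>2)"
    using assms by (auto simp: L2_space_def)
  show "(\<lambda>x. f x * g x) \<in> borel_measurable M"
    using assms by (auto simp: L2_space_def)
  have "\<bar>a * b\<bar> \<le> a\<^sup>2 + b\<^sup>2" for a b :: real
  proof -
    have "2 * (\<bar>a\<bar> * \<bar>b\<bar>) \<le> a\<^sup>2 + b\<^sup>2" "0 \<le> \<bar>a\<bar> * \<bar>b\<bar>"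
      using sum_squares_bound[of "\<bar>a\<bar>" "\<bar>b\<bar>"] by auto
    then show ?thesis unfolding abs_mult by linarith
  qed
  then show "AE x in M. norm (f x * g x) \<le> norm ((f x)\<^sup>2 + (g x)\<^sup>2)"
    by auto
qed

text \<open>The arithmetic-mean form of Cauchy-Schwarz, enough where both second moments have the
  same bound.\<close>

lemma abs_integral_mult_le:
  assumes "f \<in> L2_space M" "g \<in> L2_space M"
  shows "\<bar>\<integral>x. f x * g x \<partial>M\<bar> \<le> ((\<integral>x. (f x)\<^sup>2 \<partial>M) + (\<integral>x. (g x)\<^sup>2 \<partial>M)) / 2"
proof -
  have int: "integrable M (\<lambda>x. (f x)\<^sup>2)" "integrable M (\<lambda>x. (g x)\<^sup>2)"
    using assms by (auto simp: L2_space_def)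
  have "\<bar>\<integral>x. f x * g x \<partial>M\<bar> \<le> (\<integral>x. ((f x)\<^sup>2 + (g x)\<^sup>2) / 2 \<partial>M)"
  proof (rule order_trans[OF integral_abs_bound integral_mono])
    fix x
    show "\<bar>f x * g x\<bar> \<le> ((f x)\<^sup>2 + (g x)\<^sup>2) / 2"
      using sum_squares_bound[of "\<bar>f x\<bar>" "\<bar>g x\<bar>"] by (simp add: abs_mult)
  qed (use int integrable_mult_L2_space[OF assms] in auto)
  then show ?thesis using int by simp
qed

text \<open>With truncated subtraction the exponent is \<open>\<bar>i - k\<bar>\<close>. On either
  side of \<open>i\<close> the exponents are distinct, so each side is part of a geometric
  series.\<close>

lemma sum_power_distance_le:
  fixes r :: real
  assumes "0 \<le> r" "r < 1" "finite S"
  shows "(\<Sum>k\<in>S. r ^ ((i - k) + (k - i))) \<le> 2 / (1 - r)"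
proof -
  have geo: "sum (\<lambda>n. r ^ n) F \<le> 1 / (1 - r)" if "finite F" for F
    using sum_le_suminf[of "\<lambda>n. r ^ n" F] summable_geometric[of r] suminf_geometric[of r] assms that by auto
  have "(\<Sum>k\<in>S. r ^ ((i - k) + (k - i))) =
      (\<Sum>k\<in>S \<inter> {..i}. r ^ ((i - k) + (k - i))) + (\<Sum>k\<in>S - {..i}. r ^ ((i - k) + (k - i)))"
    by (rule sum.Int_Diff) fact
  also have "(\<Sum>k\<in>S \<inter> {..i}. r ^ ((i - k) + (k - i))) = sum (\<lambda>n. r ^ n) ((\<lambda>k. i - k) ` (S \<inter> {..i}))"
    by (subst sum.reindex) (auto simp: inj_on_def intro!: sum.cong)
  also have "\<dots> \<le> 1 / (1 - r)" using assms by (intro geo) auto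
  also have "(\<Sum>k\<in>S - {..i}. r ^ ((i - k) + (k - i))) = sum (\<lambda>n. r ^ n) ((\<lambda>k. k - i) ` (S - {..i}))"
    by (subst sum.reindex) (auto simp: inj_on_def intro!: sum.cong)
  also have "\<dots> \<le> 1 / (1 - r)" using assms by (intro geo) auto
  finally show ?thesis by simp
qed

text \<open>Schur's test.\<close>

lemma quasi_orthogonal_system_L2I:
  fixes r :: real
  assumes f: "\<And>i. i \<ge> 1 \<Longrightarrow> f i \<in> L2_space M" and r: "0 \<le> r" "r < 1"
    and G: "\<And>i k. 1 \<le> i \<Longrightarrow> i \<le> k \<Longrightarrow> \<bar>\<integral>x. f i x * f k x \<partial>M\<bar> \<le> A * r ^ (k - i)"
  shows "quasi_orthogonal_system_L2 M f"
proof -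
  define G' where "G' i k = (\<integral>x. f i x * f k x \<partial>M)" for i k
  define d where "d i k = (i - k) + (k - i)" for i k :: nat
  \<comment> \<open>For \<open>i = k = 1\<close> the power of \<open>r\<close> is 1.\<close>
  have A: "A \<ge> 0" using order_trans[OF abs_ge_zero G[of 1 1]] by simp
  have G': "\<bar>G' i k\<bar> \<le> A * r ^ d i k" if "i \<ge> 1" "k \<ge> 1" for i k
    using that G[of i k] G[of k i] by (cases "i \<le> k") (auto simp: G'_def d_def mult.commute)
  have "L2_norm M (\<lambda>x. \<Sum>i=1..n. y i * f i x) \<le> sqrt (A * (2 / (1 - r))) * sqrt (\<Sum>i=1..n. \<bar>y i\<bar>\<^sup>2)"
    for n and y :: "nat \<Rightarrow> real"
  proof -
    have "(\<integral>x. (\<Sum>i=1..n. y i * f i x)\<^sup>2 \<partial>M)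
        = (\<integral>x. (\<Sum>i=1..n. \<Sum>k=1..n. (y i * y k) * (f i x * f k x)) \<partial>M)"
      by (simp add: power2_eq_square sum_product algebra_simps)
    also have "\<dots> = (\<Sum>i=1..n. \<Sum>k=1..n. (y i * y k) * G' i k)"
    proof -
      have int: "integrable M (\<lambda>x. (y i * y k) * (f i x * f k x))" if "i \<in> {1..n}" "k \<in> {1..n}" for i k
        using that f by (intro integrable_mult_right integrable_mult_L2_space) auto
      have "(\<integral>x. (\<Sum>i=1..n. \<Sum>k=1..n. (y i * y k) * (f i x * f k x)) \<partial>M)
          = (\<Sum>i=1..n. \<integral>x. (\<Sum>k=1..n. (y i * y k) * (f i x * f k x)) \<partial>M)"
        by (intro Bochner_Integration.integral_sum Bochner_Integration.integrable_sum int)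
      also have "\<dots> = (\<Sum>i=1..n. \<Sum>k=1..n. \<integral>x. (y i * y k) * (f i x * f k x) \<partial>M)"
        by (intro sum.cong refl Bochner_Integration.integral_sum int)
      finally show ?thesis unfolding G'_def by simp
    qed
    also have "\<dots> \<le> (\<Sum>i=1..n. \<Sum>k=1..n. (A * r ^ d i k) * ((y i)\<^sup>2 / 2 + (y k)\<^sup>2 / 2))"
    proof (intro sum_mono)
      fix i k assume "i \<in> {1..n}" "k \<in> {1..n}"
      then have "\<bar>G' i k\<bar> \<le> A * r ^ d i k" by (intro G') auto
      moreover have "\<bar>y i * y k\<bar> \<le> (y i)\<^sup>2 / 2 + (y k)\<^sup>2 / 2"
        using sum_squares_bound[of "\<bar>y i\<bar>" "\<bar>y k\<bar>"] by (simp add: abs_mult)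
      ultimately have "\<bar>G' i k\<bar> * \<bar>y i * y k\<bar> \<le> (A * r ^ d i k) * ((y i)\<^sup>2 / 2 + (y k)\<^sup>2 / 2)"
        by (intro mult_mono) (use A r in auto)
      moreover have "(y i * y k) * G' i k \<le> \<bar>G' i k\<bar> * \<bar>y i * y k\<bar>"
        using abs_ge_self[of "(y i * y k) * G' i k"] by (simp add: abs_mult mult.commute)
      ultimately show "(y i * y k) * G' i k \<le> (A * r ^ d i k) * ((y i)\<^sup>2 / 2 + (y k)\<^sup>2 / 2)"
        by (rule order_trans[rotated])
    qed
    also have "\<dots> = (\<Sum>i=1..n. \<Sum>k=1..n. (A * r ^ d i k) * ((y i)\<^sup>2 / 2))
        + (\<Sum>i=1..n. \<Sum>k=1..n. (A * r ^ d i k) * ((y k)\<^sup>2 / 2))"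
      by (simp add: distrib_left sum.distrib)
    \<comment> \<open>By symmetry of \<open>d\<close> the two halves agree, and only the row sums of
      \<open>r ^ d i k\<close> remain to be bounded.\<close>
    also have "(\<Sum>i=1..n. \<Sum>k=1..n. (A * r ^ d i k) * ((y k)\<^sup>2 / 2))
       = (\<Sum>i=1..n. \<Sum>k=1..n. (A * r ^ d i k) * ((y i)\<^sup>2 / 2))"
      by (subst sum.swap) (simp add: d_def add.commute)
    also have "(\<Sum>i=1..n. \<Sum>k=1..n. (A * r ^ d i k) * ((y i)\<^sup>2 / 2))
        + (\<Sum>i=1..n. \<Sum>k=1..n. (A * r ^ d i k) * ((y i)\<^sup>2 / 2))
       = (\<Sum>i=1..n. A * (\<Sum>k=1..n. r ^ d i k) * (y i)\<^sup>2)"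
    proof -
      have "(\<Sum>k=1..n. (A * r ^ d i k) * ((y i)\<^sup>2 / 2)) = A * (\<Sum>k=1..n. r ^ d i k) * (y i)\<^sup>2 / 2" for i
        by (simp only: sum_distrib_left sum_distrib_right sum_divide_distrib times_divide_eq_right)
      then show ?thesis by (simp flip: sum_divide_distrib)
    qed
    also have "\<dots> \<le> (\<Sum>i=1..n. A * (2 / (1 - r)) * (y i)\<^sup>2)"
      using A r by (intro sum_mono mult_right_mono mult_left_mono)
        (auto simp: d_def sum_power_distance_le)
    also have "\<dots> = A * (2 / (1 - r)) * (\<Sum>i=1..n. \<bar>y i\<bar>\<^sup>2)"
      by (simp add: sum_distrib_left)
    finally show ?thesis
      unfolding L2_norm_def real_sqrt_mult[symmetric] by (rule real_sqrt_le_mono)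
  qed
  then show ?thesis
    using f unfolding quasi_orthogonal_system_L2_def by blast
qed

section \<open>Dyadic blocks\<close>

text \<open>Starting at 3 matters: \<open>ln 3 > 1\<close> keeps \<open>1 - cramer_theta n\<close>
  away from 0, so that variances are comparable to \<open>cramer_nu\<close>.\<close>

lemma cramer_theta_bounds:
  assumes "3 \<le> n"
  shows "0 < cramer_theta n" "cramer_theta n \<le> 1 / ln 3" "cramer_theta n < 1"
proof -
  have "ln 3 \<le> ln (real n)" using assms by simp
  then show "0 < cramer_theta n" "cramer_theta n \<le> 1 / ln 3" "cramer_theta n < 1"
    using ln3_gt_1 by (auto simp: cramer_theta_def intro!: divide_left_mono)
qed

lemma cramer_theta_nonneg: "3 \<le> n \<Longrightarrow> 0 \<le> cramer_theta n"
  using cramer_theta_bounds(1) less_imp_le by blast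

lemma cramer_nu_Suc: "n \<ge> 2 \<Longrightarrow> cramer_nu (Suc n) = cramer_nu n + cramer_theta (Suc n)"
  by (simp add: cramer_nu_def)

lemma cramer_nu_diff:
  assumes "2 \<le> m" "m \<le> n"
  shows "cramer_nu n - cramer_nu m = (\<Sum>j=Suc m..n. cramer_theta j)"
  using assms(2,1) by (induction rule: dec_induct) (auto simp: cramer_nu_Suc)

lemma cramer_nu_mono: "2 \<le> m \<Longrightarrow> m \<le> n \<Longrightarrow> cramer_nu m \<le> cramer_nu n"
  using cramer_nu_diff[of m n] sum_nonneg[of "{Suc m..n}" cramer_theta] cramer_theta_nonneg
  by auto

lemma cramer_nu_strict_mono: "2 \<le> m \<Longrightarrow> m < n \<Longrightarrow> cramer_nu m < cramer_nu n"
  using cramer_nu_mono[of "Suc m" n] cramer_nu_Suc[of m] cramer_theta_bounds[of "Suc m"] by simp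

definition cramer_block :: "nat \<Rightarrow> nat set" where
  "cramer_block i = {n. 3 \<le> n \<and> 2 ^ i \<le> cramer_nu n \<and> cramer_nu n < 2 ^ (i + 1)}"

text \<open>The last of the \<open>n - 2\<close> terms of \<open>cramer_nu n\<close> is the
  smallest, so \<open>cramer_nu n \<ge> (n - 2) / ln n\<close>, which tends to infinity.\<close>

lemma finite_cramer_block: "finite (cramer_block i)"
proof -
  have "filterlim (\<lambda>n::nat. (real n - 2) / ln (real n)) at_top at_top"
    by real_asymp
  then have "eventually (\<lambda>n. 2 ^ (i + 1) \<le> (real n - 2) / ln (real n)) at_top"
    by (rule filterlim_at_top_dense[THEN iffD1, rule_format, THEN eventually_mono, of _ _ "2 ^ (i + 1)"]) simp
  then obtain N where N: "\<And>n. n \<ge> N \<Longrightarrow> 2 ^ (i + 1) \<le> (real n - 2) / ln (real n)"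
    by (auto simp: eventually_at_top_linorder)
  have "(real n - 2) / ln (real n) \<le> cramer_nu n" if "n \<ge> 3" for n
  proof -
    have "(real n - 2) / ln (real n) = (\<Sum>j=3..n. cramer_theta n)"
      using that by (simp add: cramer_theta_def of_nat_diff)
    also have "\<dots> \<le> cramer_nu n"
      unfolding cramer_nu_def cramer_theta_def by (intro sum_mono divide_left_mono) auto
    finally show ?thesis .
  qed
  then have "n \<le> N" if "n \<in> cramer_block i" for n
    using that N[of n] by (fastforce simp: cramer_block_def)
  then have "cramer_block i \<subseteq> {..N}" by auto
  then show ?thesis by (rule finite_subset) simp
qed

text \<open>The sum is part of \<open>cramer_nu N\<close> for the largest element \<open>N\<close>
  of the block.\<close>

lemma sum_theta_cramer_block_le: "(\<Sum>n\<in>cramer_block i. cramer_theta n) \<le> 2 ^ (i + 1)"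
proof (cases "cramer_block i = {}")
  case False
  define N where "N = Max (cramer_block i)"
  have N: "N \<in> cramer_block i" using Max_in[OF finite_cramer_block False] by (simp add: N_def)
  have "n \<le> N" if "n \<in> cramer_block i" for n
    using that finite_cramer_block by (simp add: N_def)
  then have "(\<Sum>n\<in>cramer_block i. cramer_theta n) \<le> cramer_nu N"
    unfolding cramer_nu_def
    by (intro sum_mono2) (auto simp: cramer_block_def intro!: cramer_theta_nonneg)
  then show ?thesis using N by (simp add: cramer_block_def)
qed simp

lemma cramer_weight_bounds:
  assumes "n \<in> cramer_block i"
  shows "0 \<le> cramer_theta n / sqrt (cramer_nu n)"
    and "cramer_theta n / sqrt (cramer_nu n) \<le> cramer_theta n / sqrt (2 ^ i)"
proof -
  have n: "3 \<le> n" "2 ^ i \<le> cramer_nu n" using assms by (auto simp: cramer_block_def)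
  have pos: "0 < (2::real) ^ i" by simp
  then have "0 < cramer_nu n" using n(2) by linarith
  then show "0 \<le> cramer_theta n / sqrt (cramer_nu n)"
    using cramer_theta_nonneg[OF n(1)] by simp
  show "cramer_theta n / sqrt (cramer_nu n) \<le> cramer_theta n / sqrt (2 ^ i)"
    using n pos \<open>0 < cramer_nu n\<close> by (intro divide_left_mono cramer_theta_nonneg) simp_all
qed

text \<open>Riemann-sum comparison with the integral of the inverse square root:
  \<open>(b - a) / \<surd>b \<le> 2 (\<surd>b - \<surd>a)\<close>, telescoped.\<close>

lemma sum_theta_div_sqrt_nu_le:
  assumes "2 \<le> m" "m \<le> N"
  shows "(\<Sum>n=Suc m..N. cramer_theta n / sqrt (cramer_nu n - cramer_nu m)) \<le> 2 * sqrt (cramer_nu N - cramer_nu m)"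
  using assms(2)
proof (induction rule: dec_induct)
  case (step N)
  define a b where "a = cramer_nu N - cramer_nu m" and "b = cramer_nu (Suc N) - cramer_nu m"
  have a: "a \<ge> 0" using step assms cramer_nu_mono[of m N] by (simp add: a_def)
  have b: "b > 0" "a \<le> b" and \<theta>: "cramer_theta (Suc N) = b - a"
    using step assms cramer_nu_strict_mono[of m "Suc N"] cramer_nu_Suc[of N] cramer_theta_bounds[of "Suc N"]
    by (simp_all add: a_def b_def)
  have "b - a = (sqrt b - sqrt a) * (sqrt b + sqrt a)"
    using a b by (simp add: algebra_simps)
  then have "(b - a) / sqrt b = (sqrt b - sqrt a) * ((sqrt b + sqrt a) / sqrt b)"
    by (metis times_divide_eq_right)
  also have "\<dots> \<le> (sqrt b - sqrt a) * 2"
    using a b by (intro mult_left_mono) (auto simp: field_simps)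
  finally have "cramer_theta (Suc N) / sqrt b \<le> 2 * sqrt b - 2 * sqrt a"
    by (simp add: \<theta>)
  then show ?case using step by (simp add: a_def b_def)
qed simp

text \<open>With \<open>a^2 = 2^i\<close> and \<open>b^2 = 2^k\<close>, the weights of the two
  blocks sum to at most \<open>2 * a\<close> and \<open>2 * b\<close>, and the separation gives
  \<open>\<bar>c m n\<bar> \<le> 2 * K / b^2\<close>. The product is
  \<open>8 * K * (a / b)\<close>.\<close>

lemma cramer_block_far_sum_le:
  assumes K: "K \<ge> 0"
    and c: "\<And>m n. 3 \<le> m \<Longrightarrow> m < n \<Longrightarrow> \<bar>c m n\<bar> \<le> K / (cramer_nu n - cramer_nu m)"
    and ik: "i + 2 \<le> k"
  shows "(\<Sum>m\<in>cramer_block i. \<Sum>n\<in>cramer_block k.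
      cramer_theta m / sqrt (cramer_nu m) * (cramer_theta n / sqrt (cramer_nu n)) * \<bar>c m n\<bar>)
     \<le> 8 * K * (1 / sqrt 2) ^ (k - i)"
proof -
  \<comment> \<open>A whole block lies in between, so \<open>cramer_nu n - cramer_nu m\<close>
    exceeds \<open>2^k - 2^(i+1) \<ge> 2^(k-1)\<close>.\<close>
  have pw: "(2::real) ^ (i + 1) \<le> 2 ^ (k - 1)" "(2::real) ^ k = 2 * 2 ^ (k - 1)"
    using ik by (auto intro: power_increasing simp flip: power_Suc)
  define a b where "a = sqrt (2 ^ i :: real)" and "b = sqrt (2 ^ k :: real)"
  have ab: "a > 0" "b > 0" "a * a = 2 ^ i" "b * b = 2 ^ k" by (auto simp: a_def b_def)
  have "cramer_theta m / sqrt (cramer_nu m) * (cramer_theta n / sqrt (cramer_nu n)) * \<bar>c m n\<bar>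
     \<le> cramer_theta m / a * (cramer_theta n / b) * (2 * K / (b * b))"
    if m: "m \<in> cramer_block i" and n: "n \<in> cramer_block k" for m n
  proof -
    have m3: "3 \<le> m" "3 \<le> n" using m n by (auto simp: cramer_block_def)
    have le: "cramer_nu m < 2 ^ (i + 1)" "2 ^ k \<le> cramer_nu n" "2 ^ i \<le> cramer_nu m"
      using m n by (auto simp: cramer_block_def)
    then have "cramer_nu m < cramer_nu n" using pw zero_less_power[of "2::real" "k - 1"] by linarith
    then have "m < n" using cramer_nu_mono[of n m] m3 by (cases "n \<le> m") auto
    then have "\<bar>c m n\<bar> \<le> K / (cramer_nu n - cramer_nu m)" using c m3 by auto
    also have "\<dots> \<le> K / (2 ^ (k - 1))"
      using le pw K by (intro divide_left_mono) auto
    also have "\<dots> = 2 * K / (b * b)" by (simp add: ab pw)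
    finally have c_le: "\<bar>c m n\<bar> \<le> 2 * K / (b * b)" .
    have "cramer_theta m / sqrt (cramer_nu m) * (cramer_theta n / sqrt (cramer_nu n))
        \<le> cramer_theta m / a * (cramer_theta n / b)"
      unfolding a_def b_def
      by (rule mult_mono[OF cramer_weight_bounds(2)[OF m] cramer_weight_bounds(2)[OF n] _
            cramer_weight_bounds(1)[OF n]]) (use cramer_theta_nonneg m3 in simp)
    then show ?thesis
      by (rule mult_mono[OF _ c_le]) (use cramer_theta_nonneg m3 ab in simp_all)
  qed
  then have "(\<Sum>m\<in>cramer_block i. \<Sum>n\<in>cramer_block k.
      cramer_theta m / sqrt (cramer_nu m) * (cramer_theta n / sqrt (cramer_nu n)) * \<bar>c m n\<bar>)
    \<le> (\<Sum>m\<in>cramer_block i. \<Sum>n\<in>cramer_block k. cramer_theta m / a * (cramer_theta n / b) * (2 * K / (b * b)))"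
    by (intro sum_mono) auto
  also have "\<dots> = (\<Sum>m\<in>cramer_block i. cramer_theta m) / a * ((\<Sum>n\<in>cramer_block k. cramer_theta n) / b) * (2 * K / (b * b))"
    unfolding sum_divide_distrib unfolding sum_product by (simp only: sum_distrib_right)
  also have "\<dots> \<le> 2 ^ (i + 1) / a * (2 ^ (k + 1) / b) * (2 * K / (b * b))"
    using ab K
    by (intro mult_right_mono mult_mono divide_right_mono sum_theta_cramer_block_le
        divide_nonneg_pos sum_nonneg) (auto simp: cramer_block_def intro!: cramer_theta_nonneg)
  also have "\<dots> = 8 * K * (a / b)"
    using ab by (simp flip: ab(3,4) add: field_simps)
  also have "a / b = (1 / sqrt 2) ^ (k - i)"
    using ik unfolding a_def b_def real_sqrt_power
    by (simp add: power_diff power_one_over field_simps)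
  finally show ?thesis .
qed

text \<open>The singularity \<open>1 / sqrt (cramer_nu n - cramer_nu m)\<close> is summable: the
  part of row \<open>m\<close> above the diagonal contributes at most
  \<open>2 * K * cramer_theta m\<close>. The part below doubles this, the diagonal adds
  \<open>cramer_theta m\<close>, and the sum over the block is at most \<open>2^(i+1)\<close>
  against the normalisation \<open>2^i\<close>.\<close>

lemma cramer_block_near_sum_le:
  assumes K: "K \<ge> 0"
    and c: "\<And>m n. 3 \<le> m \<Longrightarrow> m < n \<Longrightarrow> \<bar>c m n\<bar> \<le> K / sqrt (cramer_nu m * (cramer_nu n - cramer_nu m))"
    and sym: "\<And>m n. c m n = c n m"
    and diag: "\<And>n. \<bar>c n n\<bar> \<le> 1"
  shows "(\<Sum>m\<in>cramer_block i. \<Sum>n\<in>cramer_block i.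
      cramer_theta m / sqrt (cramer_nu m) * (cramer_theta n / sqrt (cramer_nu n)) * \<bar>c m n\<bar>)
     \<le> 2 + 8 * K"
proof -
  let ?B = "cramer_block i"
  define a where "a = sqrt (2 ^ i :: real)"
  have a: "a > 0" "a * a = 2 ^ i" by (auto simp: a_def)
  let ?u = "\<lambda>m n. cramer_theta m * cramer_theta n * \<bar>c m n\<bar>"
  have B3: "3 \<le> n" "0 \<le> cramer_theta n" "cramer_theta n \<le> 1" "2 ^ i \<le> cramer_nu n" "cramer_nu n < 2 ^ (i + 1)"
    if "n \<in> ?B" for n
    using that cramer_theta_bounds[of n] by (auto simp: cramer_block_def less_imp_le)
  have upper: "(\<Sum>n\<in>?B \<inter> {m<..}. ?u m n) \<le> 2 * K * cramer_theta m" if m: "m \<in> ?B" for m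
  proof -
    define N where "N = Max ?B"
    have N: "N \<in> ?B" "m \<le> N" using m finite_cramer_block by (auto simp: N_def intro!: Max_in)
    have "(\<Sum>n\<in>?B \<inter> {m<..}. ?u m n) \<le>
       (\<Sum>n\<in>?B \<inter> {m<..}. (cramer_theta m * (K / a)) * (cramer_theta n / sqrt (cramer_nu n - cramer_nu m)))"
    proof (rule sum_mono)
      fix n assume n: "n \<in> ?B \<inter> {m<..}"
      then have d: "cramer_nu n - cramer_nu m > 0"
        using B3[OF m] cramer_nu_strict_mono[of m n] by auto
      have "\<bar>c m n\<bar> \<le> K / sqrt (cramer_nu m * (cramer_nu n - cramer_nu m))"
        using n B3[OF m] by (intro c) auto
      also have "\<dots> \<le> K / (a * sqrt (cramer_nu n - cramer_nu m))"
        unfolding a_def real_sqrt_mult[symmetric] using d B3[OF m] K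
        by (intro divide_left_mono real_sqrt_le_mono mult_right_mono) (auto intro!: mult_pos_pos order_less_le_trans[OF zero_less_power])
      finally have "?u m n \<le> cramer_theta m * cramer_theta n * (K / (a * sqrt (cramer_nu n - cramer_nu m)))"
        using B3 m n by (intro mult_left_mono) auto
      then show "?u m n \<le> (cramer_theta m * (K / a)) * (cramer_theta n / sqrt (cramer_nu n - cramer_nu m))"
        by (simp add: mult_ac)
    qed
    \<comment> \<open>Nonnegative terms are added to reach a full interval, where the telescoping
      bound applies.\<close>
    also have "\<dots> \<le> (\<Sum>n\<in>{Suc m..N}. (cramer_theta m * (K / a)) * (cramer_theta n / sqrt (cramer_nu n - cramer_nu m)))"
    proof (rule sum_mono2)
      show "?B \<inter> {m<..} \<subseteq> {Suc m..N}" using finite_cramer_block by (auto simp: N_def)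
      fix n assume "n \<in> {Suc m..N} - ?B \<inter> {m<..}"
      then show "0 \<le> (cramer_theta m * (K / a)) * (cramer_theta n / sqrt (cramer_nu n - cramer_nu m))"
        using B3[OF m] K a cramer_nu_mono[of m n] cramer_theta_bounds[of n] by (auto intro!: mult_nonneg_nonneg divide_nonneg_nonneg)
    qed simp
    also have "\<dots> \<le> (cramer_theta m * (K / a)) * (2 * sqrt (cramer_nu N - cramer_nu m))"
      unfolding sum_distrib_left[symmetric] using B3[OF m] K a N
      by (intro mult_left_mono sum_theta_div_sqrt_nu_le) auto
    also have "\<dots> \<le> (cramer_theta m * (K / a)) * (2 * a)"
    proof -
      \<comment> \<open>A dyadic block has length \<open>2^i\<close>, so the square root is at most
        \<open>a\<close> and cancels \<open>1 / a\<close>.\<close>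
      have "cramer_nu N - cramer_nu m \<le> 2 ^ i" using B3[OF m] B3[OF N(1)] by simp
      then show ?thesis unfolding a_def using B3[OF m] K by (intro mult_left_mono real_sqrt_le_mono) auto
    qed
    also have "\<dots> = 2 * K * cramer_theta m" using a by simp
    finally show ?thesis .
  qed
  have "(\<Sum>m\<in>?B. \<Sum>n\<in>?B. cramer_theta m / sqrt (cramer_nu m) * (cramer_theta n / sqrt (cramer_nu n)) * \<bar>c m n\<bar>)
     \<le> (\<Sum>m\<in>?B. \<Sum>n\<in>?B. ?u m n / 2 ^ i)"
  proof (intro sum_mono)
    fix m n assume mn: "m \<in> ?B" "n \<in> ?B"
    have "cramer_theta m / sqrt (cramer_nu m) * (cramer_theta n / sqrt (cramer_nu n)) \<le> cramer_theta m / a * (cramer_theta n / a)"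
      unfolding a_def
      by (rule mult_mono[OF cramer_weight_bounds(2)[OF mn(1)] cramer_weight_bounds(2)[OF mn(2)] _
            cramer_weight_bounds(1)[OF mn(2)]]) (use B3[OF mn(1)] in simp)
    also have "\<dots> = cramer_theta m * cramer_theta n / 2 ^ i" by (simp flip: a(2))
    finally show "cramer_theta m / sqrt (cramer_nu m) * (cramer_theta n / sqrt (cramer_nu n)) * \<bar>c m n\<bar> \<le> ?u m n / 2 ^ i"
      using mult_right_mono[of _ _ "\<bar>c m n\<bar>"] by fastforce
  qed
  also have "\<dots> = (\<Sum>m\<in>?B. \<Sum>n\<in>?B. ?u m n) / 2 ^ i"
    by (simp add: sum_divide_distrib)
  also have "(\<Sum>m\<in>?B. \<Sum>n\<in>?B. ?u m n)
      = (\<Sum>m\<in>?B. (\<Sum>n\<in>?B \<inter> {m<..}. ?u m n) + (\<Sum>n\<in>?B \<inter> {..<m}. ?u m n) + ?u m m)"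
  proof (rule sum.cong[OF refl])
    fix m assume m: "m \<in> ?B"
    have "?B = (?B \<inter> {m<..}) \<union> (?B \<inter> {..<m}) \<union> {m}" using m by auto
    then have "(\<Sum>n\<in>?B. ?u m n) = (\<Sum>n\<in>(?B \<inter> {m<..}) \<union> (?B \<inter> {..<m}) \<union> {m}. ?u m n)" by simp
    also have "\<dots> = (\<Sum>n\<in>?B \<inter> {m<..}. ?u m n) + (\<Sum>n\<in>?B \<inter> {..<m}. ?u m n) + ?u m m"
      using finite_cramer_block by (subst sum.union_disjoint; auto)+
    finally show "(\<Sum>n\<in>?B. ?u m n) = (\<Sum>n\<in>?B \<inter> {m<..}. ?u m n) + (\<Sum>n\<in>?B \<inter> {..<m}. ?u m n) + ?u m m" .
  qed
  also have "\<dots> = (\<Sum>m\<in>?B. \<Sum>n\<in>?B \<inter> {m<..}. ?u m n) + (\<Sum>m\<in>?B. \<Sum>n\<in>?B \<inter> {..<m}. ?u m n) + (\<Sum>m\<in>?B. ?u m m)"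
    by (simp add: sum.distrib)
  \<comment> \<open>Exchanging the order of summation reflects the lower triangle onto the upper
    one, using \<open>sym\<close>.\<close>
  also have "(\<Sum>m\<in>?B. \<Sum>n\<in>?B \<inter> {..<m}. ?u m n) = (\<Sum>m\<in>?B. \<Sum>n\<in>?B \<inter> {m<..}. ?u m n)"
  proof -
    have "(\<Sum>m\<in>?B. \<Sum>n\<in>?B \<inter> {..<m}. ?u m n) = (\<Sum>m\<in>?B. \<Sum>n\<in>{n\<in>?B. n < m}. ?u m n)"
      by (intro sum.cong) auto
    also have "\<dots> = (\<Sum>n\<in>?B. \<Sum>m\<in>{m\<in>?B. n < m}. ?u m n)"
      using finite_cramer_block by (intro sum.swap_restrict)
    also have "\<dots> = (\<Sum>n\<in>?B. \<Sum>m\<in>?B \<inter> {n<..}. ?u n m)"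
      by (intro sum.cong) (auto simp: sym mult.commute)
    finally show ?thesis .
  qed
  also have "(\<Sum>m\<in>?B. \<Sum>n\<in>?B \<inter> {m<..}. ?u m n) + (\<Sum>m\<in>?B. \<Sum>n\<in>?B \<inter> {m<..}. ?u m n) + (\<Sum>m\<in>?B. ?u m m)
     \<le> (\<Sum>m\<in>?B. 2 * K * cramer_theta m) + (\<Sum>m\<in>?B. 2 * K * cramer_theta m) + (\<Sum>m\<in>?B. cramer_theta m)"
  proof (intro add_mono sum_mono upper)
    fix m assume "m \<in> ?B"
    then show "?u m m \<le> cramer_theta m"
      using B3[of m] diag[of m] mult_mono[of "cramer_theta m" 1 "\<bar>c m m\<bar>" 1]
      by (simp add: mult.assoc mult_left_le)
  qed
  also have "\<dots> = (1 + 4 * K) * (\<Sum>m\<in>?B. cramer_theta m)"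
    by (simp only: sum_distrib_left[symmetric]) (simp add: algebra_simps)
  also have "\<dots> \<le> (1 + 4 * K) * 2 ^ (i + 1)"
    using K by (intro mult_left_mono sum_theta_cramer_block_le) auto
  also have "(1 + 4 * K) * 2 ^ (i + 1) / 2 ^ i = 2 + 8 * K" by simp
  finally show ?thesis by (simp add: divide_right_mono)
qed

section \<open>Covariances in the Cramer model\<close>

text \<open>One constant \<open>C\<close> serves both boundedness hypotheses. With
  \<open>\<kappa> 2 = 0\<close>, the case \<open>i = 2\<close> of \<open>concentration\<close>
  concerns the sums themselves.\<close>

locale cramer_model = indep_bernoulli M \<xi> "{3..}" cramer_theta
  for M :: "'a measure" and \<xi> :: "nat \<Rightarrow> 'a \<Rightarrow> real" +
  fixes \<kappa> :: "nat \<Rightarrow> int" and C :: real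
  assumes \<kappa>_2: "\<kappa> 2 = 0"
    and deviation: "j \<ge> 3 \<Longrightarrow> \<bar>(of_int (\<kappa> j) - cramer_mean M \<xi> j) / cramer_sd M \<xi> j\<bar> \<le> C"
    and concentration: "2 \<le> i \<Longrightarrow> i \<le> j \<Longrightarrow>
           sqrt ((cramer_sd M \<xi> j)\<^sup>2 - (cramer_sd M \<xi> i)\<^sup>2)
             * \<P>(x in M. cramer_S \<xi> j x - cramer_S \<xi> i x = of_int (\<kappa> j - \<kappa> i)) \<le> C"
begin

definition hit :: "nat \<Rightarrow> real" where
  "hit n = \<P>(x in M. cramer_S \<xi> n x = of_int (\<kappa> n))"

definition inc :: "nat \<Rightarrow> nat \<Rightarrow> real" where
  "inc m n = \<P>(x in M. cramer_S \<xi> n x - cramer_S \<xi> m x = of_int (\<kappa> n - \<kappa> m))"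

definition cov :: "nat \<Rightarrow> nat \<Rightarrow> real" where
  "cov m n = \<P>(x in M. cramer_S \<xi> m x = of_int (\<kappa> m) \<and> cramer_S \<xi> n x = of_int (\<kappa> n)) - hit m * hit n"

text \<open>A uniform lower bound for \<open>1 - cramer_theta j\<close>, hence for the ratio of
  variance to \<open>cramer_nu\<close> over any range of indices.\<close>

definition c\<^sub>0 :: real where "c\<^sub>0 = 1 - 1 / ln 3"

lemma c0_pos: "c\<^sub>0 > 0"
  using ln3_gt_1 by (simp add: c\<^sub>0_def)

lemma C_nonneg: "C \<ge> 0"
  using deviation[of 3] by linarith

section \<open>Mean, variance and point probabilities of sums and increments\<close>

lemma measurable_S [measurable]: "cramer_S \<xi> n \<in> borel_measurable M"
  unfolding cramer_S_def[abs_def] by (rule measurable_sum_X) auto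

lemma cramer_mean_eq: "cramer_mean M \<xi> n = (\<Sum>j=3..n. cramer_theta j)"
  unfolding cramer_mean_def cramer_S_def[abs_def] by (rule expectation_sum_X) auto

lemma cramer_sd_square: "(cramer_sd M \<xi> n)\<^sup>2 = (\<Sum>j=3..n. cramer_theta j * (1 - cramer_theta j))"
proof -
  have "variance (cramer_S \<xi> n) = (\<Sum>j=3..n. cramer_theta j * (1 - cramer_theta j))"
    unfolding cramer_S_def[abs_def] by (rule variance_sum_X) auto
  then show ?thesis
    unfolding cramer_sd_def by (metis real_sqrt_pow2 variance_positive)
qed

lemma cramer_sd_square_diff:
  assumes "2 \<le> m" "m \<le> n"
  shows "(cramer_sd M \<xi> n)\<^sup>2 - (cramer_sd M \<xi> m)\<^sup>2 = (\<Sum>j=Suc m..n. cramer_theta j * (1 - cramer_theta j))"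
proof -
  have "{3..n} = {3..m} \<union> {Suc m..n}" "{3..m} \<inter> {Suc m..n} = {}" using assms by auto
  then show ?thesis unfolding cramer_sd_square by (simp add: sum.union_disjoint)
qed

lemma cramer_S_diff:
  assumes "2 \<le> m" "m \<le> n"
  shows "cramer_S \<xi> n x - cramer_S \<xi> m x = (\<Sum>j=Suc m..n. \<xi> j x)"
proof -
  have "{3..n} = {3..m} \<union> {Suc m..n}" "{3..m} \<inter> {Suc m..n} = {}" using assms by auto
  then show ?thesis unfolding cramer_S_def by (simp add: sum.union_disjoint)
qed

lemma variance_ge:
  assumes "2 \<le> m" "m \<le> n"
  shows "c\<^sub>0 * (cramer_nu n - cramer_nu m) \<le> (\<Sum>j=Suc m..n. cramer_theta j * (1 - cramer_theta j))"
  unfolding cramer_nu_diff[OF assms] sum_distrib_left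
proof (rule sum_mono)
  fix j assume "j \<in> {Suc m..n}"
  then have "3 \<le> j" using assms by auto
  then show "c\<^sub>0 * cramer_theta j \<le> cramer_theta j * (1 - cramer_theta j)"
    using mult_left_mono[of c\<^sub>0 "1 - cramer_theta j" "cramer_theta j"] cramer_theta_bounds(2)[of j]
      cramer_theta_nonneg[of j] by (simp add: c\<^sub>0_def mult.commute)
qed

text \<open>The anti-concentration hypothesis, with the variance of the increment replaced by its
  lower bound \<open>c\<^sub>0 * (cramer_nu n - cramer_nu m)\<close>.\<close>

lemma inc_le:
  assumes "2 \<le> m" "m < n"
  shows "inc m n \<le> C / sqrt (c\<^sub>0 * (cramer_nu n - cramer_nu m))"
proof -
  let ?v = "\<Sum>j=Suc m..n. cramer_theta j * (1 - cramer_theta j)"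
  have pos: "0 < c\<^sub>0 * (cramer_nu n - cramer_nu m)"
    using c0_pos cramer_nu_strict_mono[OF assms] by simp
  have ge: "c\<^sub>0 * (cramer_nu n - cramer_nu m) \<le> ?v" using variance_ge assms by simp
  have "sqrt ?v * inc m n \<le> C"
    using concentration[of m n] cramer_sd_square_diff[of m n] assms by (simp add: inc_def)
  then have "inc m n \<le> C / sqrt ?v"
    using pos ge by (simp add: field_simps)
  also have "\<dots> \<le> C / sqrt (c\<^sub>0 * (cramer_nu n - cramer_nu m))"
    using pos ge C_nonneg by (intro divide_left_mono) simp_all
  finally show ?thesis .
qed

text \<open>The instance of anti-concentration with start 2, where sum, variance and target all
  vanish.\<close>

lemma sd_pos: "3 \<le> n \<Longrightarrow> cramer_sd M \<xi> n > 0"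
  and hit_le_sd: "3 \<le> n \<Longrightarrow> hit n \<le> C / cramer_sd M \<xi> n"
  and hit_le: "3 \<le> n \<Longrightarrow> hit n \<le> C / sqrt (c\<^sub>0 * cramer_nu n)"
proof -
  assume n: "3 \<le> n"
  have nu2: "cramer_nu 2 = 0" by (simp add: cramer_nu_def)
  have sd2: "cramer_sd M \<xi> 2 = 0" using cramer_sd_square[of 2] by simp
  have S2: "cramer_S \<xi> 2 x = 0" for x by (simp add: cramer_S_def)
  have "0 < c\<^sub>0 * cramer_nu n" using c0_pos cramer_nu_strict_mono[of 2 n] n nu2 by simp
  also have "\<dots> \<le> (cramer_sd M \<xi> n)\<^sup>2"
    using variance_ge[of 2 n] n nu2 by (simp add: cramer_sd_square)
  finally have "cramer_sd M \<xi> n \<noteq> 0" by auto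
  moreover have nonneg: "cramer_sd M \<xi> n \<ge> 0" unfolding cramer_sd_def using variance_positive by simp
  ultimately show pos: "cramer_sd M \<xi> n > 0" by simp
  have "cramer_sd M \<xi> n * hit n \<le> C"
    using concentration[of 2 n] n nonneg by (simp add: sd2 S2 \<kappa>_2 hit_def)
  then show "hit n \<le> C / cramer_sd M \<xi> n" using pos by (simp add: field_simps)
  show "hit n \<le> C / sqrt (c\<^sub>0 * cramer_nu n)"
    using inc_le[of 2 n] n by (simp add: inc_def hit_def S2 \<kappa>_2 nu2)
qed

section \<open>Covariances of the hitting events\<close>

lemma cov_eq:
  assumes "3 \<le> m" "m < n"
  shows "cov m n = hit m * (inc m n - hit n)"
proof -
  have D: "cramer_S \<xi> n x - cramer_S \<xi> m x = (\<Sum>j=Suc m..n. \<xi> j x)" for x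
    using assms by (intro cramer_S_diff) auto
  \<comment> \<open>Given the first event, the second is one about the increment, which involves a
    disjoint set of indices.\<close>
  have "(cramer_S \<xi> m x = of_int (\<kappa> m) \<and> cramer_S \<xi> n x = of_int (\<kappa> n)) \<longleftrightarrow>
      (\<Sum>j=3..m. \<xi> j x) = of_int (\<kappa> m) \<and> (\<Sum>j=Suc m..n. \<xi> j x) = of_int (\<kappa> n - \<kappa> m)" for x
    using D[of x] by (auto simp: cramer_S_def)
  then have "\<P>(x in M. cramer_S \<xi> m x = of_int (\<kappa> m) \<and> cramer_S \<xi> n x = of_int (\<kappa> n)) = hit m * inc m n"
    unfolding inc_def hit_def D using assms
    by (simp only: cramer_S_def) (rule prob_sums_eq, auto)
  then show ?thesis by (simp add: cov_def right_diff_distrib)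
qed

lemma cov_commute: "cov m n = cov n m"
  by (simp add: cov_def conj_commute mult.commute)

lemma abs_cov_le_1: "\<bar>cov m n\<bar> \<le> 1"
proof -
  have "0 \<le> hit m * hit n" "hit m * hit n \<le> 1"
    unfolding hit_def by (auto intro!: mult_le_one)
  moreover have "0 \<le> cov m n + hit m * hit n" "cov m n + hit m * hit n \<le> 1"
    unfolding cov_def by auto
  ultimately show ?thesis by linarith
qed

text \<open>The Lipschitz estimate costs a factor \<open>?\<sigma>\<close>, the mean deviation of
  \<open>S_m\<close>, which cancels against \<open>hit m \<le> C / ?\<sigma>\<close>.\<close>

lemma cov_far_le:
  assumes "3 \<le> m" "m < n"
  shows "\<bar>cov m n\<bar> \<le> (C * (1 + C) / c\<^sub>0) / (cramer_nu n - cramer_nu m)"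
proof -
  let ?v = "\<Sum>j=Suc m..n. cramer_theta j * (1 - cramer_theta j)" and ?\<sigma> = "cramer_sd M \<xi> m"
  have pos: "0 < c\<^sub>0 * (cramer_nu n - cramer_nu m)"
    using c0_pos cramer_nu_strict_mono[of m n] assms by simp
  have ge: "c\<^sub>0 * (cramer_nu n - cramer_nu m) \<le> ?v" using variance_ge assms by simp
  have \<sigma>: "?\<sigma> > 0" using sd_pos assms by simp
  have D: "cramer_S \<xi> n x - cramer_S \<xi> m x = (\<Sum>j=Suc m..n. \<xi> j x)" for x
    using assms by (intro cramer_S_diff) auto
  have "{3..m} \<union> {Suc m..n} = {3..n}" using assms by auto
  \<comment> \<open>The target is split as \<open>\<kappa> m\<close> plus the increment, the form
    \<open>k + l\<close> of \<open>prob_sum_union_diff_le\<close>.\<close>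
  then have "hit n = \<P>(x in M. (\<Sum>j\<in>{3..m} \<union> {Suc m..n}. \<xi> j x) = of_int (\<kappa> m + (\<kappa> n - \<kappa> m)))"
    by (simp add: hit_def cramer_S_def)
  moreover have "inc m n = \<P>(x in M. (\<Sum>j=Suc m..n. \<xi> j x) = of_int (\<kappa> n - \<kappa> m))"
    by (simp only: inc_def D)
  ultimately have "\<bar>inc m n - hit n\<bar> \<le> expectation (\<lambda>x. \<bar>(\<Sum>j=3..m. \<xi> j x) - of_int (\<kappa> m)\<bar>) / ?v"
    using prob_sum_union_diff_le[of "{3..m}" "{Suc m..n}" "\<kappa> n - \<kappa> m" "\<kappa> m"] pos ge assms
    by (simp only:) auto
  also have "\<dots> \<le> (1 + C) * ?\<sigma> / ?v"
  proof (intro divide_right_mono expectation_abs_deviation_le)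
    show "\<bar>of_int (\<kappa> m) - (\<Sum>j=3..m. cramer_theta j)\<bar> \<le> C * ?\<sigma>"
      using deviation[of m] assms \<sigma> by (simp add: cramer_mean_eq abs_divide field_simps)
  qed (use \<sigma> pos ge in \<open>auto simp: cramer_sd_square\<close>)
  also have "\<dots> \<le> (1 + C) * ?\<sigma> / (c\<^sub>0 * (cramer_nu n - cramer_nu m))"
  proof (rule divide_left_mono[OF ge])
    have "0 < ?v" using pos ge by linarith
    then show "0 < ?v * (c\<^sub>0 * (cramer_nu n - cramer_nu m))" using pos by (rule mult_pos_pos)
  qed (use \<sigma> C_nonneg in simp)
  finally have le: "\<bar>inc m n - hit n\<bar> \<le> (1 + C) * ?\<sigma> / (c\<^sub>0 * (cramer_nu n - cramer_nu m))" .
  have "\<bar>cov m n\<bar> = hit m * \<bar>inc m n - hit n\<bar>"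
    unfolding cov_eq[OF assms] abs_mult by (simp add: hit_def)
  also have "\<dots> \<le> (C / ?\<sigma>) * ((1 + C) * ?\<sigma> / (c\<^sub>0 * (cramer_nu n - cramer_nu m)))"
    using hit_le_sd[OF assms(1)] le \<sigma> C_nonneg by (intro mult_mono) auto
  also have "\<dots> = (C * (1 + C) / c\<^sub>0) / (cramer_nu n - cramer_nu m)"
    using \<sigma> by simp
  finally show ?thesis .
qed

text \<open>Both \<open>inc m n\<close> and \<open>hit n\<close> lie between 0 and
  \<open>C / sqrt (c\<^sub>0 * ?d)\<close>, the latter because \<open>cramer_nu n \<ge> ?d\<close>;
  so does the modulus of their difference.\<close>

lemma cov_near_le:
  assumes "3 \<le> m" "m < n"
  shows "\<bar>cov m n\<bar> \<le> (C * C / c\<^sub>0) / sqrt (cramer_nu m * (cramer_nu n - cramer_nu m))"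
proof -
  let ?d = "cramer_nu n - cramer_nu m"
  have d: "?d > 0" using cramer_nu_strict_mono[of m n] assms by simp
  have m: "cramer_nu m > 0" using cramer_nu_strict_mono[of 2 m] assms by (simp add: cramer_nu_def)
  have inc: "0 \<le> inc m n" "inc m n \<le> C / sqrt (c\<^sub>0 * ?d)"
    using inc_le[of m n] assms by (auto simp: inc_def)
  have "hit n \<le> C / sqrt (c\<^sub>0 * cramer_nu n)" using hit_le[of n] assms by simp
  also have "\<dots> \<le> C / sqrt (c\<^sub>0 * ?d)"
    using d m c0_pos C_nonneg by (intro divide_left_mono real_sqrt_le_mono mult_left_mono) auto
  finally have hit: "hit n \<le> C / sqrt (c\<^sub>0 * ?d)" .
  have hit0: "0 \<le> hit n" "0 \<le> hit m" by (auto simp: hit_def)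
  have "\<bar>cov m n\<bar> = hit m * \<bar>inc m n - hit n\<bar>"
    unfolding cov_eq[OF assms] abs_mult using hit0 by simp
  also have "\<dots> \<le> (C / sqrt (c\<^sub>0 * cramer_nu m)) * (C / sqrt (c\<^sub>0 * ?d))"
    using hit_le[OF assms(1)] inc hit hit0 c0_pos C_nonneg m by (intro mult_mono) auto
  also have "\<dots> = C * C / ((sqrt c\<^sub>0 * sqrt c\<^sub>0) * sqrt (cramer_nu m * ?d))"
    by (simp add: real_sqrt_mult)
  also have "\<dots> = (C * C / c\<^sub>0) / sqrt (cramer_nu m * ?d)"
    using c0_pos by simp
  finally show ?thesis .
qed

section \<open>Gram matrix of the block sums\<close>

definition Y :: "nat \<Rightarrow> 'a \<Rightarrow> real" where
  "Y n x = of_bool (cramer_S \<xi> n x = of_int (\<kappa> n)) - hit n"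

lemma measurable_Y [measurable]: "Y n \<in> borel_measurable M"
  unfolding Y_def[abs_def] by measurable

lemma abs_Y_le: "\<bar>Y n x\<bar> \<le> 1"
proof -
  have "0 \<le> hit n" "hit n \<le> 1" by (auto simp: hit_def)
  then show ?thesis by (auto simp: Y_def)
qed

lemma integrable_Y_mult: "integrable M (\<lambda>x. Y m x * Y n x)"
  using abs_Y_le by (intro integrable_const_bound[where B=1]) (auto simp: abs_mult intro!: mult_le_one)

lemma expectation_Y_mult: "expectation (\<lambda>x. Y m x * Y n x) = cov m n"
proof -
  let ?E = "\<lambda>n. {x \<in> space M. cramer_S \<xi> n x = of_int (\<kappa> n)}"
  let ?i = "\<lambda>A. indicator A :: 'a \<Rightarrow> real"
  have int: "integrable M (?i A)" if "A \<in> events" for A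
    using that by (intro integrable_const_bound[where B=1]) (auto simp: indicator_def)
  have "expectation (\<lambda>x. Y m x * Y n x) =
    expectation (\<lambda>x. ?i (?E m \<inter> ?E n) x - hit n * ?i (?E m) x - hit m * ?i (?E n) x + hit m * hit n)"
    by (intro Bochner_Integration.integral_cong) (auto simp: Y_def indicator_def algebra_simps)
  also have "\<dots> = prob (?E m \<inter> ?E n) - hit n * prob (?E m) - hit m * prob (?E n) + hit m * hit n"
    using int by (simp add: prob_space)
  also have "?E m \<inter> ?E n = {x \<in> space M. cramer_S \<xi> m x = of_int (\<kappa> m) \<and> cramer_S \<xi> n x = of_int (\<kappa> n)}"
    by auto
  finally show ?thesis
    by (simp add: cov_def flip: hit_def)
qed

lemma cramer_Z_eq:
  "cramer_Z M \<xi> \<kappa> i x = (\<Sum>n\<in>cramer_block i. cramer_theta n / sqrt (cramer_nu n) * Y n x)"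
  unfolding cramer_Z_def cramer_block_def Y_def hit_def by simp

lemma cramer_Z_mult_eq: "cramer_Z M \<xi> \<kappa> i x * cramer_Z M \<xi> \<kappa> k x =
  (\<Sum>m\<in>cramer_block i. \<Sum>n\<in>cramer_block k.
      cramer_theta m / sqrt (cramer_nu m) * (cramer_theta n / sqrt (cramer_nu n)) * (Y m x * Y n x))"
  unfolding cramer_Z_eq sum_product by (intro sum.cong refl) (simp only: mult_ac)

lemma cramer_Z_in_L2: "cramer_Z M \<xi> \<kappa> i \<in> L2_space M"
proof -
  have [measurable]: "cramer_Z M \<xi> \<kappa> i \<in> borel_measurable M"
    unfolding cramer_Z_eq[abs_def] by measurable
  have "integrable M (\<lambda>x. cramer_Z M \<xi> \<kappa> i x * cramer_Z M \<xi> \<kappa> i x)"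
    unfolding cramer_Z_mult_eq
    by (intro Bochner_Integration.integrable_sum integrable_mult_right integrable_Y_mult)
  then show ?thesis
    by (simp add: L2_space_def power2_eq_square)
qed

lemma abs_expectation_Z_mult_le:
  "\<bar>expectation (\<lambda>x. cramer_Z M \<xi> \<kappa> i x * cramer_Z M \<xi> \<kappa> k x)\<bar> \<le>
  (\<Sum>m\<in>cramer_block i. \<Sum>n\<in>cramer_block k.
      cramer_theta m / sqrt (cramer_nu m) * (cramer_theta n / sqrt (cramer_nu n)) * \<bar>cov m n\<bar>)"
proof -
  let ?w = "\<lambda>m n. cramer_theta m / sqrt (cramer_nu m) * (cramer_theta n / sqrt (cramer_nu n))"
  have "expectation (\<lambda>x. cramer_Z M \<xi> \<kappa> i x * cramer_Z M \<xi> \<kappa> k x) =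
      (\<Sum>m\<in>cramer_block i. expectation (\<lambda>x. \<Sum>n\<in>cramer_block k. ?w m n * (Y m x * Y n x)))"
    unfolding cramer_Z_mult_eq
    by (intro Bochner_Integration.integral_sum Bochner_Integration.integrable_sum integrable_mult_right integrable_Y_mult)
  also have "\<dots> = (\<Sum>m\<in>cramer_block i. \<Sum>n\<in>cramer_block k. expectation (\<lambda>x. ?w m n * (Y m x * Y n x)))"
    by (intro sum.cong refl Bochner_Integration.integral_sum integrable_mult_right integrable_Y_mult)
  also have "\<dots> = (\<Sum>m\<in>cramer_block i. \<Sum>n\<in>cramer_block k. ?w m n * cov m n)"
    by (simp only: integral_mult_right_zero expectation_Y_mult)
  finally have E: "expectation (\<lambda>x. cramer_Z M \<xi> \<kappa> i x * cramer_Z M \<xi> \<kappa> k x)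
      = (\<Sum>m\<in>cramer_block i. \<Sum>n\<in>cramer_block k. ?w m n * cov m n)" .
  show ?thesis
    unfolding E
  proof (intro order_trans[OF sum_abs sum_mono] order_trans[OF sum_abs])
    fix m n assume "m \<in> cramer_block i" "n \<in> cramer_block k"
    then have "0 \<le> ?w m n" by (intro mult_nonneg_nonneg cramer_weight_bounds(1))
    then have "\<bar>?w m n\<bar> = ?w m n" by (rule abs_of_nonneg)
    then show "\<bar>?w m n * cov m n\<bar> \<le> ?w m n * \<bar>cov m n\<bar>"
      unfolding abs_mult[of "?w m n" "cov m n"] by (simp only: order_refl)
  qed
qed

lemma quasi_orthogonal_cramer_Z: "quasi_orthogonal_system_L2 M (cramer_Z M \<xi> \<kappa>)"
proof -
  \<comment> \<open>The far constant also dominates the near constant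
    \<open>C * C / c\<^sub>0\<close>.\<close>
  define K where "K = C * (1 + C) / c\<^sub>0"
  have K: "K \<ge> 0" using C_nonneg c0_pos by (simp add: K_def)
  have near: "\<bar>cov m n\<bar> \<le> K / sqrt (cramer_nu m * (cramer_nu n - cramer_nu m))" if "3 \<le> m" "m < n" for m n
  proof -
    have "C * C / c\<^sub>0 \<le> K"
      unfolding K_def using C_nonneg c0_pos by (intro divide_right_mono mult_left_mono) auto
    moreover have "0 \<le> cramer_nu m * (cramer_nu n - cramer_nu m)"
      using cramer_nu_mono[of 2 m] cramer_nu_mono[of m n] that by (simp add: cramer_nu_def)
    ultimately show ?thesis
      by (intro order_trans[OF cov_near_le[OF that]] divide_right_mono) auto
  qed
  let ?D = "2 + 8 * K" and ?Z = "cramer_Z M \<xi> \<kappa>"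
  let ?r = "1 / sqrt 2 :: real"
  have diag: "\<bar>expectation (\<lambda>x. ?Z i x * ?Z i x)\<bar> \<le> ?D" for i
    using cramer_block_near_sum_le[OF K near cov_commute abs_cov_le_1] abs_expectation_Z_mult_le
    by (rule order_trans[rotated])
  show ?thesis
  \<comment> \<open>The ratio comes from the far bound. The factor 2 absorbs neighbouring blocks,
    where \<open>?r ^ (k - i) \<ge> 1 / 2\<close>, and \<open>2 * ?D\<close> exceeds the far
    constant \<open>8 * K\<close>.\<close>
  proof (rule quasi_orthogonal_system_L2I[where r = ?r and A = "2 * ?D"])
    fix i k :: nat assume "1 \<le> i" and ik: "i \<le> k"
    consider "k \<le> i + 1" | "i + 2 \<le> k" by linarith
    then show "\<bar>expectation (\<lambda>x. ?Z i x * ?Z k x)\<bar> \<le> 2 * ?D * ?r ^ (k - i)"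
    proof cases
      case 1
      \<comment> \<open>Adjacent blocks are not separated in \<open>cramer_nu\<close>, so their
        product is controlled through the two second moments.\<close>
      have "\<bar>expectation (\<lambda>x. ?Z i x * ?Z k x)\<bar> \<le> ?D"
        using abs_integral_mult_le[OF cramer_Z_in_L2 cramer_Z_in_L2, of i k] diag[of i] diag[of k]
        by (simp add: power2_eq_square)
      also have "\<dots> = 2 * ?D * (1 / 2)" by simp
      also have "\<dots> \<le> 2 * ?D * ?r ^ (k - i)"
      proof (rule mult_left_mono)
        have "1 / 2 \<le> ?r" using real_sqrt_le_mono[of 2 4] by (simp add: field_simps)
        moreover have "k - i = 0 \<or> k - i = 1" using 1 ik by auto
        ultimately show "1 / 2 \<le> ?r ^ (k - i)" by auto
      qed (use K in simp)
      finally show ?thesis .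
    next
      case 2
      have "\<bar>expectation (\<lambda>x. ?Z i x * ?Z k x)\<bar> \<le> 8 * K * ?r ^ (k - i)"
        using cramer_block_far_sum_le[OF K cov_far_le[folded K_def] 2] abs_expectation_Z_mult_le
        by (rule order_trans[rotated])
      also have "\<dots> \<le> 2 * ?D * ?r ^ (k - i)"
        using K by (intro mult_right_mono) auto
      finally show ?thesis .
    qed
  qed (auto intro: cramer_Z_in_L2)
qed

end

theorem corollary5p16:
  fixes M :: "'a measure" and \<xi> :: "nat \<Rightarrow> 'a \<Rightarrow> real" and \<kappa> :: "nat \<Rightarrow> int"
  assumes "prob_space M"
    and "prob_space.indep_vars M (\<lambda>_. borel) \<xi> {3..}"
    and "\<And>j. j \<ge> 3 \<Longrightarrow> measure M {x \<in> space M. \<xi> j x = 1} = 1 / ln (real j)"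
    and "\<And>j. j \<ge> 3 \<Longrightarrow> measure M {x \<in> space M. \<xi> j x = 0} = 1 - 1 / ln (real j)"
    and "\<kappa> 2 = 0"
    and "\<exists>C. \<forall>j\<ge>3. \<bar>(of_int (\<kappa> j) - cramer_mean M \<xi> j) / cramer_sd M \<xi> j\<bar> \<le> C"
    and "\<exists>C. \<forall>i\<ge>2. \<forall>j\<ge>i.
           sqrt ((cramer_sd M \<xi> j)\<^sup>2 - (cramer_sd M \<xi> i)\<^sup>2)
             * measure M {x \<in> space M. cramer_S \<xi> j x - cramer_S \<xi> i x = of_int (\<kappa> j - \<kappa> i)} \<le> C"
  shows "quasi_orthogonal_system_L2 M (cramer_Z M \<xi> \<kappa>)"
proof -
  interpret indep_bernoulli M \<xi> "{3..}" cramer_theta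
    using assms(1-4) by (intro indep_bernoulli.intro indep_bernoulli_axioms.intro) (auto simp: cramer_theta_def)
  obtain C1 C2 where C1: "\<forall>j\<ge>3. \<bar>(of_int (\<kappa> j) - cramer_mean M \<xi> j) / cramer_sd M \<xi> j\<bar> \<le> C1"
    and C2: "\<forall>i\<ge>2. \<forall>j\<ge>i. sqrt ((cramer_sd M \<xi> j)\<^sup>2 - (cramer_sd M \<xi> i)\<^sup>2)
             * measure M {x \<in> space M. cramer_S \<xi> j x - cramer_S \<xi> i x = of_int (\<kappa> j - \<kappa> i)} \<le> C2"
    using assms(6,7) by blast
  interpret cramer_model M \<xi> \<kappa> "max C1 C2"
  proof
    show "\<kappa> 2 = 0" by fact
    show "\<bar>(of_int (\<kappa> j) - cramer_mean M \<xi> j) / cramer_sd M \<xi> j\<bar> \<le> max C1 C2" if "3 \<le> j" for j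
      using C1 that by (meson max.coboundedI1)
    show "sqrt ((cramer_sd M \<xi> j)\<^sup>2 - (cramer_sd M \<xi> i)\<^sup>2)
             * \<P>(x in M. cramer_S \<xi> j x - cramer_S \<xi> i x = of_int (\<kappa> j - \<kappa> i)) \<le> max C1 C2"
      if "2 \<le> i" "i \<le> j" for i j
      using C2 that by (meson max.coboundedI2)
  qed
  show ?thesis by (rule quasi_orthogonal_cramer_Z)
qed

end
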